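(* Let $n\ge1$, $a<b$, $\gamma\in\mathbb{R}$, and let $L$ satisfy hypotheses (H1) and (H2) stated in the context. Consider the problem of extremizing $z[x;b]$, where $z=z[x;\cdot]$ satisfies $$\dot z(t)=L\left(t,x(t),\dot x(t),\ldots,x^{(n)}(t),z(t)\right),\quad t\in[a,b],\qquad z(a)=\gamma,$$ among functions $x\in C^{2n}([a,b],\mathbb{R})$, where each of the values $x(a),\ldots,x^{(n-1)}(a),x(b),\ldots,x^{(n-1)}(b)$ is either prescribed (equal to a given real number) or free (no condition imposed on it). Suppose that $x$ is a solution (minimizer or maximizer) of this problem, and set $$\lambda(t):=e^{-\int_a^t\frac{\partial L}{\partial z}\langle x,z\rangle_n(\theta)\,d\theta}.$$ Then $x$ satisfies the generalized Euler--Lagrange equation $$\sum_{j=0}^{n}(-1)^j\frac{d^j}{dt^j}\left(\lambda(t)\,\frac{\partial L}{\partial x^{(j)}}\langle x,z\rangle_n(t)\right)=0,\qquad t\in[a,b].$$ Moreover: 1. If $x^{(k)}(b)$, $k\in\{0,\ldots,n-1\}$, is free, then the natural boundary condition $$\sum_{j=1}^{n-k}(-1)^{j-1}\frac{d^{j-1}}{dt^{j-1}}\left(\lambda(t)\,\frac{\partial L}{\partial x^{(k+j)}}\langle x,z\rangle_n(t)\right)\Bigg|_{t=b}=0$$ holds. 2. If $x^{(k)}(a)$, $k\in\{0,\ldots,n-1\}$, is free, then the natural boundary condition $$\sum_{j=1}^{n-k}(-1)^{j-1}\frac{d^{j-1}}{dt^{j-1}}\left(\lambda(t)\,\frac{\partial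 L}{\partial x^{(k+j)}}\langle x,z\rangle_n(t)\right)\Bigg|_{t=a}=0$$ holds.
   Context: Notation: $x^{(0)}=x$; $\langle x,z\rangle_n(t):=\left(t,x(t),\dot x(t),\ldots,x^{(n)}(t),z(t)\right)$. The Lagrangian $L$ is a function of the $n+3$ real variables $(t,x,\dot x,\ldots,x^{(n)},z)$; $\frac{\partial L}{\partial x^{(j)}}$ and $\frac{\partial L}{\partial z}$ denote its partial derivatives with respect to the variables $x^{(j)}$ ($j=0,\ldots,n$) and $z$. An admissible trajectory is a function $x\in C^{2n}([a,b],\mathbb{R})$ that satisfies the imposed boundary conditions (if any) and for which the initial value problem $\dot z(t)=L\left(t,x(t),\dot x(t),\ldots,x^{(n)}(t),z(t)\right)$, $z(a)=\gamma$, has a solution $z$ on all of $[a,b]$; this solution is denoted $z(t)=z[x;t]$. The number $\gamma$ is fixed and does not depend on $x$. A solution of the problem (an extremizer) is an admissible trajectory $x$ which minimizes $z[\,\cdot\,;b]$ over all admissible trajectories, or maximizes it over all admissible trajectories. Hypotheses on $L$: (H1) $L\in C^1(\mathbb{R}^{n+3},\mathbb{R})$. (H2) For any admissible trajectory $x$ (with $z=z[x;\cdot]$), the functions $t\mapsto\frac{\partial L}{\partial x^{(j)}}\langle x,z\rangle_n(t)$, $j=0,\ldots,n$, and $t\mapsto\frac{\partial L}{\partial z}\langle x,z\rangle_n(t)$ are differentiable up to order $n$ on $[a,b]$. *)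

theory Defs
  imports "HOL-Analysis.Analysis"
begin

text \<open>Derivatives relative to a set: for a closed interval these are one-sided at the endpoints,
  so values of \<open>f\<close> outside the interval are irrelevant.\<close>

definition nderiv_on :: "real set \<Rightarrow> nat \<Rightarrow> (real \<Rightarrow> real) \<Rightarrow> real \<Rightarrow> real" where
  "nderiv_on S k f = ((\<lambda>g t. vector_derivative g (at t within S)) ^^ k) f"

definition times_differentiable_on :: "nat \<Rightarrow> (real \<Rightarrow> real) \<Rightarrow> real set \<Rightarrow> bool" where
  "times_differentiable_on k f S \<longleftrightarrow> (\<forall>i<k. nderiv_on S i f differentiable_on S)"

definition Ck_on :: "nat \<Rightarrow> (real \<Rightarrow> real) \<Rightarrow> real set \<Rightarrow> bool" where
  "Ck_on k f S \<longleftrightarrow> times_differentiable_on k f S \<and> continuous_on S (nderiv_on S k f)"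

definition C1_UNIV :: "('a::real_normed_vector \<Rightarrow> real) \<Rightarrow> bool" where
  "C1_UNIV f \<longleftrightarrow>
     (\<exists>f'. (\<forall>p. (f has_derivative blinfun_apply (f' p)) (at p)) \<and> continuous_on UNIV f')"

text \<open>The space of the variables \<open>(t, x, x', \<dots>, x\<^sup>(\<^sup>n\<^sup>), z)\<close> is \<open>real \<times> (real ^ 'm) \<times> real\<close>.
  The index type \<open>'m\<close> is numbered by a bijection \<open>idx\<close> from \<open>'m\<close> onto \<open>{..n}\<close>:
  the component with index \<open>i\<close> holds the variable \<open>x\<^sup>(\<^sup>j\<^sup>)\<close> for \<open>j = idx i\<close>.\<close>

type_synonym 'm vars = "real \<times> (real ^ 'm) \<times> real"

definition partial_x :: "('m::finite \<Rightarrow> nat) \<Rightarrow> ('m vars \<Rightarrow> real) \<Rightarrow> nat \<Rightarrow> 'm vars \<Rightarrow> real" where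
  "partial_x idx L j = (\<lambda>(t, y, z).
     deriv (\<lambda>s. L (t, (\<chi> i. if idx i = j then s else y $ i), z)) (y $ inv idx j))"

definition partial_z :: "('m::finite vars \<Rightarrow> real) \<Rightarrow> 'm vars \<Rightarrow> real" where
  "partial_z L = (\<lambda>(t, y, z). deriv (\<lambda>s. L (t, y, s)) z)"

definition bracket ::
    "('m::finite \<Rightarrow> nat) \<Rightarrow> real \<Rightarrow> real \<Rightarrow> (real \<Rightarrow> real) \<Rightarrow> (real \<Rightarrow> real) \<Rightarrow> real \<Rightarrow> 'm vars" where
  "bracket idx a b x z t = (t, (\<chi> i. nderiv_on {a..b} (idx i) x t), z t)"

definition solves_ivp ::
    "('m::finite \<Rightarrow> nat) \<Rightarrow> ('m vars \<Rightarrow> real) \<Rightarrow> real \<Rightarrow> real \<Rightarrow> real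
      \<Rightarrow> (real \<Rightarrow> real) \<Rightarrow> (real \<Rightarrow> real) \<Rightarrow> bool" where
  "solves_ivp idx L a b \<gamma> x z \<longleftrightarrow>
     z a = \<gamma> \<and>
     (\<forall>t\<in>{a..b}. (z has_real_derivative L (bracket idx a b x z t)) (at t within {a..b}))"

text \<open>\<open>z[x;t]\<close>. The description is over the value at \<open>t\<close> rather than over the function \<open>z\<close>,
  because a solution is unique (for \<open>L\<close> of class \<open>C\<^sup>1\<close>) only on \<open>[a,b]\<close>.\<close>

definition z_of ::
    "('m::finite \<Rightarrow> nat) \<Rightarrow> ('m vars \<Rightarrow> real) \<Rightarrow> real \<Rightarrow> real \<Rightarrow> real
      \<Rightarrow> (real \<Rightarrow> real) \<Rightarrow> real \<Rightarrow> real" where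
  "z_of idx L a b \<gamma> x t = (THE r. \<exists>z. solves_ivp idx L a b \<gamma> x z \<and> z t = r)"

text \<open>Boundary data: \<open>Some v\<close> at \<open>k\<close> prescribes the value \<open>v\<close> for the \<open>k\<close>-th derivative,
  \<open>None\<close> leaves it free. Only indices \<open>k < n\<close> matter.\<close>

definition boundary_ok ::
    "nat \<Rightarrow> real \<Rightarrow> real \<Rightarrow> (nat \<Rightarrow> real option) \<Rightarrow> (nat \<Rightarrow> real option) \<Rightarrow> (real \<Rightarrow> real) \<Rightarrow> bool" where
  "boundary_ok n a b bca bcb x \<longleftrightarrow>
     (\<forall>k<n. \<forall>v. (bca k = Some v \<longrightarrow> nderiv_on {a..b} k x a = v) \<and>
                (bcb k = Some v \<longrightarrow> nderiv_on {a..b} k x b = v))"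

definition admissible ::
    "nat \<Rightarrow> ('m::finite \<Rightarrow> nat) \<Rightarrow> ('m vars \<Rightarrow> real) \<Rightarrow> real \<Rightarrow> real \<Rightarrow> real
      \<Rightarrow> (nat \<Rightarrow> real option) \<Rightarrow> (nat \<Rightarrow> real option) \<Rightarrow> (real \<Rightarrow> real) \<Rightarrow> bool" where
  "admissible n idx L a b \<gamma> bca bcb x \<longleftrightarrow>
     Ck_on (2 * n) x {a..b} \<and> boundary_ok n a b bca bcb x \<and>
     (\<exists>z. solves_ivp idx L a b \<gamma> x z)"

definition extremizer ::
    "nat \<Rightarrow> ('m::finite \<Rightarrow> nat) \<Rightarrow> ('m vars \<Rightarrow> real) \<Rightarrow> real \<Rightarrow> real \<Rightarrow> real
      \<Rightarrow> (nat \<Rightarrow> real option) \<Rightarrow> (nat \<Rightarrow> real option) \<Rightarrow> (real \<Rightarrow> real) \<Rightarrow> bool" where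
  "extremizer n idx L a b \<gamma> bca bcb x \<longleftrightarrow>
     admissible n idx L a b \<gamma> bca bcb x \<and>
     ((\<forall>y. admissible n idx L a b \<gamma> bca bcb y \<longrightarrow> z_of idx L a b \<gamma> x b \<le> z_of idx L a b \<gamma> y b) \<or>
      (\<forall>y. admissible n idx L a b \<gamma> bca bcb y \<longrightarrow> z_of idx L a b \<gamma> y b \<le> z_of idx L a b \<gamma> x b))"

definition Lx_along ::
    "('m::finite \<Rightarrow> nat) \<Rightarrow> ('m vars \<Rightarrow> real) \<Rightarrow> real \<Rightarrow> real \<Rightarrow> real
      \<Rightarrow> (real \<Rightarrow> real) \<Rightarrow> nat \<Rightarrow> real \<Rightarrow> real" where
  "Lx_along idx L a b \<gamma> x j t = partial_x idx L j (bracket idx a b x (z_of idx L a b \<gamma> x) t)"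

definition Lz_along ::
    "('m::finite \<Rightarrow> nat) \<Rightarrow> ('m vars \<Rightarrow> real) \<Rightarrow> real \<Rightarrow> real \<Rightarrow> real
      \<Rightarrow> (real \<Rightarrow> real) \<Rightarrow> real \<Rightarrow> real" where
  "Lz_along idx L a b \<gamma> x t = partial_z L (bracket idx a b x (z_of idx L a b \<gamma> x) t)"

definition hypothesis_H2 ::
    "nat \<Rightarrow> ('m::finite \<Rightarrow> nat) \<Rightarrow> ('m vars \<Rightarrow> real) \<Rightarrow> real \<Rightarrow> real \<Rightarrow> real
      \<Rightarrow> (nat \<Rightarrow> real option) \<Rightarrow> (nat \<Rightarrow> real option) \<Rightarrow> bool" where
  "hypothesis_H2 n idx L a b \<gamma> bca bcb \<longleftrightarrow>
     (\<forall>x. admissible n idx L a b \<gamma> bca bcb x \<longrightarrow>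
        (\<forall>j\<le>n. times_differentiable_on n (Lx_along idx L a b \<gamma> x j) {a..b}) \<and>
        times_differentiable_on n (Lz_along idx L a b \<gamma> x) {a..b})"

definition weight ::
    "('m::finite \<Rightarrow> nat) \<Rightarrow> ('m vars \<Rightarrow> real) \<Rightarrow> real \<Rightarrow> real \<Rightarrow> real
      \<Rightarrow> (real \<Rightarrow> real) \<Rightarrow> real \<Rightarrow> real" where
  "weight idx L a b \<gamma> x t = exp (- integral {a..t} (Lz_along idx L a b \<gamma> x))"

end

theory Submission
  imports Defs "HOL-Computational_Algebra.Polynomial"
begin

text \<open>Only polynomial variations \<open>x + \<epsilon> \<eta>\<close> are used. Let \<open>\<zeta>\<close> solve the linearised
  equation \<open>\<zeta>' = \<Sum>\<^sub>j \<partial>L/\<partial>x\<^sup>(\<^sup>j\<^sup>) \<eta>\<^sup>(\<^sup>j\<^sup>) + \<partial>L/\<partial>z \<zeta>\<close> with \<open>\<zeta>(a) = 0\<close>. Then \<open>z + \<epsilon> \<zeta>\<close>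
  solves the perturbed initial value problem up to a defect \<open>o(\<epsilon>)\<close>, so Picard iteration started
  there yields a true solution on all of \<open>[a,b]\<close> within \<open>o(\<epsilon>)\<close> of it. This gives at once the
  admissibility of \<open>x + \<epsilon> \<eta>\<close> and the first variation \<open>\<zeta>(b)\<close>, which must vanish; the weight
  \<open>\<lambda>\<close> is the integrating factor of the linearised equation, so
  \<open>\<integral> \<lambda> \<Sum>\<^sub>j \<partial>L/\<partial>x\<^sup>(\<^sup>j\<^sup>) \<eta>\<^sup>(\<^sup>j\<^sup>) = 0\<close>. Integration by parts and the du Bois-Reymond lemma give the
  Euler-Lagrange equation; the boundary terms that remain, tested with polynomials having a single
  nonzero derivative of order below \<open>n\<close> at one endpoint, give the natural boundary conditions.\<close>

section \<open>Iterated derivatives on an interval\<close>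

lemma nderiv_on_0 [simp]: "nderiv_on S 0 f = f"
  by (simp add: nderiv_on_def)

lemma nderiv_on_Suc:
  "nderiv_on S (Suc k) f = (\<lambda>t. vector_derivative (nderiv_on S k f) (at t within S))"
  by (simp add: nderiv_on_def)

lemma nderiv_on_Suc': "nderiv_on S (Suc k) f = nderiv_on S k (nderiv_on S 1 f)"
  unfolding nderiv_on_def funpow_Suc_right by simp

lemma has_derivative_nderiv_on:
  assumes "times_differentiable_on m f S" "i < m" "t \<in> S"
  shows "(nderiv_on S i f has_real_derivative nderiv_on S (Suc i) f t) (at t within S)"
proof -
  have "nderiv_on S i f differentiable (at t within S)"
    using assms unfolding times_differentiable_on_def differentiable_on_def by blast
  then show ?thesis
    by (simp add: vector_derivative_works nderiv_on_Suc has_real_derivative_iff_has_vector_derivative)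
qed

lemma times_differentiable_on_mono:
  "times_differentiable_on m f S \<Longrightarrow> k \<le> m \<Longrightarrow> times_differentiable_on k f S"
  by (auto simp: times_differentiable_on_def)

lemma times_differentiable_on_nderiv_on:
  "times_differentiable_on (Suc m) f S \<Longrightarrow> times_differentiable_on m (nderiv_on S 1 f) S"
  unfolding times_differentiable_on_def nderiv_on_Suc'[symmetric] by auto

lemma continuous_on_nderiv_on:
  "times_differentiable_on m f S \<Longrightarrow> i < m \<Longrightarrow> continuous_on S (nderiv_on S i f)"
  by (simp add: times_differentiable_on_def differentiable_imp_continuous_on)

lemma Ck_on_imp_continuous_on_nderiv:
  "Ck_on m f S \<Longrightarrow> i \<le> m \<Longrightarrow> continuous_on S (nderiv_on S i f)"
  unfolding Ck_on_def using continuous_on_nderiv_on by (cases "i = m") auto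

section \<open>Calculus of repeatedly differentiable functions on a nondegenerate interval\<close>

context
  fixes a b :: real assumes ab: "a < b"
begin

text \<open>Tool for computing \<open>nderiv_on\<close>: guess the whole chain of derivatives. Since
  \<open>a < b\<close>, a derivative within \<open>{a..b}\<close> is unique even at the endpoints,
  so the guess must agree with \<open>nderiv_on\<close> on the interval.\<close>

lemma nderiv_on_chain:
  assumes "\<And>t. t \<in> {a..b} \<Longrightarrow> g 0 t = f t"
    and "\<And>i t. i < m \<Longrightarrow> t \<in> {a..b} \<Longrightarrow> (g i has_real_derivative g (Suc i) t) (at t within {a..b})"
  shows "i \<le> m \<Longrightarrow> t \<in> {a..b} \<Longrightarrow> nderiv_on {a..b} i f t = g i t"
    and "times_differentiable_on m f {a..b}"
proof -
  have eq: "\<forall>t\<in>{a..b}. nderiv_on {a..b} i f t = g i t" if "i \<le> m" for i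
    using that
  proof (induction i)
    case 0
    then show ?case using assms(1) by simp
  next
    case (Suc i)
    show ?case
    proof
      fix t assume t: "t \<in> {a..b}"
      have "(g i has_vector_derivative g (Suc i) t) (at t within {a..b})"
        using assms(2)[of i t] Suc t by (simp add: has_real_derivative_iff_has_vector_derivative)
      then have "(nderiv_on {a..b} i f has_vector_derivative g (Suc i) t) (at t within {a..b})"
        by (rule has_vector_derivative_transform[rotated 2]) (use Suc t in auto)
      then show "nderiv_on {a..b} (Suc i) f t = g (Suc i) t"
        unfolding nderiv_on_Suc by (rule vector_derivative_within_closed_interval[OF ab t])
    qed
  qed
  show "i \<le> m \<Longrightarrow> t \<in> {a..b} \<Longrightarrow> nderiv_on {a..b} i f t = g i t"
    using eq by blast
  show "times_differentiable_on m f {a..b}"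
    unfolding times_differentiable_on_def
  proof (intro allI impI)
    fix i assume i: "i < m"
    have "g i differentiable_on {a..b}"
      using assms(2)[OF i]
      by (meson differentiable_on_def real_differentiable_def)
    then show "nderiv_on {a..b} i f differentiable_on {a..b}"
      using differentiable_transform_within eq[of i] i
      unfolding differentiable_on_def
      by (smt (verit, best) differentiable_def has_derivative_transform less_imp_le)
  qed
qed

lemma times_differentiable_on_Suc:
  assumes "\<And>t. t \<in> {a..b} \<Longrightarrow> (f has_real_derivative f' t) (at t within {a..b})"
    and "times_differentiable_on m f' {a..b}"
  shows "times_differentiable_on (Suc m) f {a..b}"
proof (rule nderiv_on_chain(2)[where g = "\<lambda>i. case i of 0 \<Rightarrow> f | Suc i \<Rightarrow> nderiv_on {a..b} i f'"])
  show "((case i of 0 \<Rightarrow> f | Suc i \<Rightarrow> nderiv_on {a..b} i f') has_real_derivative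
         (case Suc i of 0 \<Rightarrow> f | Suc i \<Rightarrow> nderiv_on {a..b} i f') t) (at t within {a..b})"
    if "i < Suc m" "t \<in> {a..b}" for i t
    using that assms(1) has_derivative_nderiv_on[OF assms(2)] by (cases i) auto
qed auto

lemma times_differentiable_on_add:
  assumes "times_differentiable_on m f {a..b}" "times_differentiable_on m g {a..b}"
  shows "times_differentiable_on m (\<lambda>t. f t + g t) {a..b}"
  by (rule nderiv_on_chain(2)[where g = "\<lambda>i t. nderiv_on {a..b} i f t + nderiv_on {a..b} i g t"])
     (auto intro!: derivative_eq_intros has_derivative_nderiv_on assms)

lemma times_differentiable_on_minus:
  assumes "times_differentiable_on m f {a..b}"
  shows "times_differentiable_on m (\<lambda>t. - f t) {a..b}"
  by (rule nderiv_on_chain(2)[where g = "\<lambda>i t. - nderiv_on {a..b} i f t"])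
     (auto intro!: derivative_eq_intros has_derivative_nderiv_on assms)

text \<open>Induction on the order replaces the Leibniz formula: by the product rule the first
  derivative is a sum of two products whose factors are \<open>m\<close> times
  differentiable.\<close>

lemma times_differentiable_on_mult:
  assumes "times_differentiable_on m f {a..b}" "times_differentiable_on m g {a..b}"
  shows "times_differentiable_on m (\<lambda>t. f t * g t) {a..b}"
  using assms
proof (induction m arbitrary: f g)
  case 0
  then show ?case by (simp add: times_differentiable_on_def)
next
  case (Suc m)
  let ?f' = "nderiv_on {a..b} 1 f" and ?g' = "nderiv_on {a..b} 1 g"
  show ?case
  proof (rule times_differentiable_on_Suc)
    show "((\<lambda>t. f t * g t) has_real_derivative ?f' t * g t + f t * ?g' t) (at t within {a..b})"
      if "t \<in> {a..b}" for t
      using has_derivative_nderiv_on[OF Suc.prems(1) _ that, of 0]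
        has_derivative_nderiv_on[OF Suc.prems(2) _ that, of 0]
      by (auto intro!: derivative_eq_intros)
    show "times_differentiable_on m (\<lambda>t. ?f' t * g t + f t * ?g' t) {a..b}"
      using Suc.prems
      by (intro times_differentiable_on_add Suc.IH times_differentiable_on_nderiv_on)
         (auto intro: times_differentiable_on_mono)
  qed
qed

text \<open>Bootstrapping: if \<open>u\<close> is \<open>k\<close> times differentiable, then so is
  \<open>c * u\<close>, which is its derivative, and \<open>u\<close> gains one order. This is how
  the weight inherits its regularity from \<open>\<partial>L/\<partial>z\<close>.\<close>

lemma times_differentiable_on_linear_ode:
  assumes "\<And>t. t \<in> {a..b} \<Longrightarrow> (u has_real_derivative c t * u t) (at t within {a..b})"
    and "times_differentiable_on m c {a..b}"
  shows "times_differentiable_on m u {a..b}"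
proof -
  have "k \<le> m \<Longrightarrow> times_differentiable_on k u {a..b}" for k
  proof (induction k)
    case 0
    then show ?case by (simp add: times_differentiable_on_def)
  next
    case (Suc k)
    show ?case
      by (rule times_differentiable_on_Suc[OF assms(1)])
         (use Suc in \<open>auto intro!: times_differentiable_on_mult times_differentiable_on_mono[OF assms(2)]\<close>)
  qed
  then show ?thesis by blast
qed

lemma nderiv_on_add_poly:
  assumes "times_differentiable_on m f {a..b}"
  shows "i \<le> m \<Longrightarrow> t \<in> {a..b} \<Longrightarrow>
      nderiv_on {a..b} i (\<lambda>s. f s + c * poly p s) t = nderiv_on {a..b} i f t + c * poly ((pderiv ^^ i) p) t"
    and "times_differentiable_on m (\<lambda>s. f s + c * poly p s) {a..b}"
proof -
  let ?g = "\<lambda>i t. nderiv_on {a..b} i f t + c * poly ((pderiv ^^ i) p) t"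
  have *: "(?g i has_real_derivative ?g (Suc i) t) (at t within {a..b})" if "i < m" "t \<in> {a..b}" for i t
    using has_derivative_nderiv_on[OF assms that] DERIV_subset[OF poly_DERIV[of "(pderiv ^^ i) p" t]]
    by (auto intro!: derivative_eq_intros)
  show "i \<le> m \<Longrightarrow> t \<in> {a..b} \<Longrightarrow> nderiv_on {a..b} i (\<lambda>s. f s + c * poly p s) t = ?g i t"
    by (rule nderiv_on_chain(1)[where g = ?g and m = m, OF _ *]) auto
  show "times_differentiable_on m (\<lambda>s. f s + c * poly p s) {a..b}"
    by (rule nderiv_on_chain(2)[where g = ?g, OF _ *]) auto
qed

lemma Ck_on_add_poly:
  assumes "Ck_on m f {a..b}"
  shows "Ck_on m (\<lambda>s. f s + c * poly p s) {a..b}"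
proof -
  have td: "times_differentiable_on m f {a..b}" using assms by (simp add: Ck_on_def)
  have "continuous_on {a..b} (\<lambda>t. nderiv_on {a..b} m f t + c * poly ((pderiv ^^ m) p) t)"
    using assms by (auto simp: Ck_on_def intro!: continuous_intros)
  then have "continuous_on {a..b} (nderiv_on {a..b} m (\<lambda>s. f s + c * poly p s))"
    by (rule continuous_on_eq) (use nderiv_on_add_poly(1)[OF td, of m] in auto)
  with nderiv_on_add_poly(2)[OF td] show ?thesis by (simp add: Ck_on_def)
qed

end

section \<open>Polynomials\<close>

text \<open>The cofactor is explicit because two things are read off from it: one power of the root
  survives the differentiation, and at \<open>c\<close> the cofactor has the value
  \<open>(1 + k) * poly r c\<close>.\<close>

lemma pderiv_root_power_mult:
  fixes r :: "real poly"
  shows "pderiv ([:- c, 1:] ^ Suc k * r) =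
    [:- c, 1:] ^ k * (smult (1 + real k) r + [:- c, 1:] * pderiv r)"
  by (simp add: pderiv_mult pderiv_power_Suc pderiv_pCons algebra_simps
        del: mult_pCons_left mult_pCons_right power_Suc)
     (simp add: algebra_simps)

text \<open>Each differentiation lowers the multiplicity of a root by at most one.\<close>

lemma higher_pderiv_root:
  fixes p :: "real poly"
  assumes "[:- c, 1:] ^ m dvd p" "k < m"
  shows "poly ((pderiv ^^ k) p) c = 0"
proof -
  have "[:- c, 1:] ^ (m - k) dvd (pderiv ^^ k) p" if "k \<le> m"
    using that
  proof (induction k)
    case 0
    then show ?case using assms by simp
  next
    case (Suc k)
    then have "m - k = Suc (m - Suc k)" by simp
    with Suc obtain r where "(pderiv ^^ k) p = [:- c, 1:] ^ Suc (m - Suc k) * r"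
      by (metis Suc_leD dvdE)
    then show ?case
      by (simp add: pderiv_root_power_mult del: power_Suc)
  qed
  then show ?thesis
    using assms(2) by (metis dvd_trans less_imp_le poly_eq_0_iff_dvd zero_less_diff dvd_power)
qed

lemma pderiv_surj:
  fixes p :: "real poly"
  obtains q where "pderiv q = p" "poly q c = 0"
proof -
  have "\<exists>q. pderiv q = p"
  proof
    show "pderiv (\<Sum>i\<le>degree p. monom (coeff p i / (i + 1)) (i + 1)) = p"
      by (subst (3) poly_as_sum_of_monoms[symmetric])
         (simp add: higher_pderiv_sum[where n = 1, simplified] pderiv_monom)
  qed
  then obtain q where "pderiv q = p" ..
  then show thesis
    using that[of "q - [:poly q c:]"] by (simp add: pderiv_diff pderiv_pCons)
qed

text \<open>Transfers Stone-Weierstrass to formal polynomials, on which \<open>pderiv\<close> and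
  divisibility by powers of a root are available.\<close>

lemma Weierstrass_poly:
  fixes f :: "real \<Rightarrow> real"
  assumes "continuous_on {a..b} f" "e > 0"
  obtains p where "\<And>t. t \<in> {a..b} \<Longrightarrow> \<bar>f t - poly p t\<bar> < e"
proof -
  obtain g where g: "real_polynomial_function g" "\<And>t. t \<in> {a..b} \<Longrightarrow> \<bar>f t - g t\<bar> < e"
    using Stone_Weierstrass_real_polynomial_function[OF compact_Icc assms] by metis
  then obtain c m where "g = (\<lambda>t. \<Sum>i\<le>m. c i * t ^ i)"
    using real_polynomial_function_iff_sum by metis
  then have "g = poly (\<Sum>i\<le>m. monom (c i) i)"
    by (auto simp: poly_sum poly_monom)
  with g that show thesis by metis
qed

lemma higher_pderiv_root_power:
  fixes r :: "real poly"
  shows "poly ((pderiv ^^ k) ([:- c, 1:] ^ k * r)) c = fact k * poly r c"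
proof (induction k arbitrary: r)
  case (Suc k)
  show ?case
    by (simp add: funpow_Suc_right pderiv_root_power_mult Suc.IH del: funpow.simps power_Suc)
qed simp

text \<open>Hermite interpolation by downward induction on \<open>k\<close>. The polynomial
  \<open>h0 = (X - q)^k (X - p)^n\<close> has vanishing derivatives of order below \<open>k\<close>
  at \<open>q\<close> and a nonzero one of order \<open>k\<close>; those of order between
  \<open>k\<close> and \<open>n\<close> are cancelled with the polynomials already found for larger
  indices.\<close>

lemma hermite_delta:
  fixes p q :: real
  assumes "p \<noteq> q" "k < n"
  obtains h where "[:- p, 1:] ^ n dvd h"
    "\<And>i. i < n \<Longrightarrow> poly ((pderiv ^^ i) h) q = (if i = k then 1 else 0)"
proof -
  have "\<exists>h. [:- p, 1:] ^ n dvd h \<and> (\<forall>i<n. poly ((pderiv ^^ i) h) q = (if i = k then 1 else 0))"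
    using assms(2)
  proof (induction "n - k" arbitrary: k rule: less_induct)
    case (less k)
    have "\<forall>l\<in>{k<..<n}. \<exists>h. [:- p, 1:] ^ n dvd h \<and>
      (\<forall>i<n. poly ((pderiv ^^ i) h) q = (if i = l then 1 else 0))"
      using less.hyps by (metis diff_less_mono2 greaterThanLessThan_iff less.prems)
    then obtain e where e: "\<And>l. l \<in> {k<..<n} \<Longrightarrow> [:- p, 1:] ^ n dvd e l"
      "\<And>l i. l \<in> {k<..<n} \<Longrightarrow> i < n \<Longrightarrow> poly ((pderiv ^^ i) (e l)) q = (if i = l then 1 else 0)"
      by metis
    define h0 where "h0 = [:- q, 1:] ^ k * [:- p, 1:] ^ n"
    define d where "d i = poly ((pderiv ^^ i) h0) q" for i
    define h where "h = smult (1 / d k) (h0 + (\<Sum>l\<in>{k<..<n}. smult (- d l) (e l)))"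
    \<comment> \<open>Here \<open>d k\<close> equals \<open>fact k * (q - p) ^ n\<close>.\<close>
    have dk: "d k \<noteq> 0"
      using assms(1) by (simp add: d_def h0_def higher_pderiv_root_power)
    have dlow: "d i = 0" if "i < k" for i
      unfolding d_def h0_def by (rule higher_pderiv_root[OF _ that]) simp
    have "[:- p, 1:] ^ n dvd h"
      unfolding h_def by (intro dvd_smult dvd_add dvd_sum) (auto simp: h0_def e)
    moreover have "poly ((pderiv ^^ i) h) q = (if i = k then 1 else 0)" if "i < n" for i
    proof -
      have "poly ((pderiv ^^ i) h) q = (d i + (\<Sum>l\<in>{k<..<n}. - d l * (if i = l then 1 else 0))) / d k"
        using that
        by (simp add: h_def higher_pderiv_smult higher_pderiv_add higher_pderiv_sum poly_sum e d_def del: smult_minus_left)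
      also have "\<dots> = (if i = k then 1 else 0)"
        using that dk dlow[of i] by (auto simp: if_distrib cong: if_cong)
      finally show ?thesis .
    qed
    ultimately show ?case by blast
  qed
  with that show thesis by metis
qed

section \<open>Ordinary differential equations\<close>

text \<open>Picard iteration started at \<open>v\<close>. In the weighted supremum norm with weight
  \<open>exp (- 2 * K * (t - a))\<close> the Picard operator contracts by the factor \<open>1/2\<close> on all of
  \<open>[a,b]\<close>, and the iterates stay in the tube around \<open>v\<close> where \<open>f\<close> is Lipschitz.\<close>

lemma picard_near_approximate_solution:
  fixes f :: "real \<Rightarrow> real \<Rightarrow> real" and v :: "real \<Rightarrow> real"
  assumes ab: "a \<le> b" and K: "0 < K" and \<delta>: "0 \<le> \<delta>"
    and contv: "continuous_on {a..b} v"
    and contf: "\<And>y. continuous_on {a..b} y \<Longrightarrow> continuous_on {a..b} (\<lambda>s. f s (y s))"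
    and lip: "\<And>s y y'. s \<in> {a..b} \<Longrightarrow> \<bar>y - v s\<bar> \<le> R \<Longrightarrow> \<bar>y' - v s\<bar> \<le> R \<Longrightarrow>
        \<bar>f s y - f s y'\<bar> \<le> K * \<bar>y - y'\<bar>"
    and defect: "\<And>t. t \<in> {a..b} \<Longrightarrow> \<bar>\<gamma> + integral {a..t} (\<lambda>s. f s (v s)) - v t\<bar> \<le> \<delta>"
    and R: "2 * \<delta> * exp (2 * K * (b - a)) \<le> R"
  obtains z where "z a = \<gamma>"
    "\<And>t. t \<in> {a..b} \<Longrightarrow> (z has_real_derivative f t (z t)) (at t within {a..b})"
    "\<And>t. t \<in> {a..b} \<Longrightarrow> \<bar>z t - v t\<bar> \<le> 2 * \<delta> * exp (2 * K * (b - a))"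
proof -
  define E where "E t = exp (2 * K * (t - a))" for t
  define \<Phi> where "\<Phi> y t = \<gamma> + integral {a..t} (\<lambda>s. f s (y s))" for y t
  define y where "y k = (\<Phi> ^^ k) v" for k
  have ySuc: "y (Suc k) = \<Phi> (y k)" for k by (simp add: y_def)
  have y0: "y 0 = v" by (simp add: y_def)
  have E1: "1 \<le> E t" if "t \<in> {a..b}" for t using that K by (simp add: E_def)
  have Eb: "E t \<le> E b" if "t \<in> {a..b}" for t using that K by (simp add: E_def)
  have \<Phi>_der: "(\<Phi> w has_real_derivative f t (w t)) (at t within {a..b})"
    if "continuous_on {a..b} w" "t \<in> {a..b}" for w t
    unfolding \<Phi>_def using integral_has_real_derivative[OF contf[OF that(1)] that(2)]
    by (auto intro!: derivative_eq_intros)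
  have \<Phi>_cont: "continuous_on {a..b} (\<Phi> w)" if "continuous_on {a..b} w" for w
    using \<Phi>_der[OF that] by (rule DERIV_continuous_on)
  have cont: "continuous_on {a..b} (y k)" for k
    by (induction k) (auto simp: y0 ySuc contv \<Phi>_cont)
  \<comment> \<open>The factor \<open>2 * (1 - (1/2) ^ k)\<close> is the geometric sum of the first
    \<open>k\<close> increment bounds. Both claims run together: staying in the tube permits the
    Lipschitz estimate, which bounds the next increment.\<close>
  have inv: "(\<forall>t\<in>{a..b}. \<bar>y k t - v t\<bar> \<le> 2 * \<delta> * (1 - (1/2) ^ k) * E t) \<and>
     (\<forall>t\<in>{a..b}. \<bar>y (Suc k) t - y k t\<bar> \<le> \<delta> * (1/2) ^ k * E t)" for k
  proof (induction k)
    case 0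
    have "\<bar>\<Phi> v t - v t\<bar> \<le> \<delta> * E t" if "t \<in> {a..b}" for t
      using defect[OF that] mult_left_mono[OF E1[OF that] \<delta>] by (simp add: \<Phi>_def)
    then show ?case by (simp add: y0 ySuc)
  next
    case (Suc k)
    have IH1: "\<bar>y k t - v t\<bar> \<le> 2 * \<delta> * (1 - (1/2) ^ k) * E t"
      and IH2: "\<bar>y (Suc k) t - y k t\<bar> \<le> \<delta> * (1/2) ^ k * E t" if "t \<in> {a..b}" for t
      using Suc that by blast+
    have 1: "\<bar>y (Suc k) t - v t\<bar> \<le> 2 * \<delta> * (1 - (1/2) ^ Suc k) * E t" if "t \<in> {a..b}" for t
    proof -
      have "\<bar>y (Suc k) t - v t\<bar> \<le> \<delta> * (1/2) ^ k * E t + 2 * \<delta> * (1 - (1/2) ^ k) * E t"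
        using IH1[OF that] IH2[OF that] by linarith
      also have "\<dots> = 2 * \<delta> * (1 - (1/2) ^ Suc k) * E t"
        by (simp add: algebra_simps)
      finally show ?thesis .
    qed
    have tube: "2 * \<delta> * (1 - (1/2) ^ j) * E t \<le> R" if "t \<in> {a..b}" for t j
    proof -
      have "2 * \<delta> * (1 - (1/2) ^ j) * E t \<le> 2 * \<delta> * 1 * E b"
        using \<delta> Eb[OF that] E1[OF that]
        by (intro mult_mono) (auto simp: power_le_one)
      with R show ?thesis by (simp add: E_def)
    qed
    have 2: "\<bar>y (Suc (Suc k)) t - y (Suc k) t\<bar> \<le> \<delta> * (1/2) ^ Suc k * E t" if t: "t \<in> {a..b}" for t
    proof -
      have sub: "{a..t} \<subseteq> {a..b}" using t by auto
      have int: "(\<lambda>s. f s (y j s)) integrable_on {a..t}" for j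
        using continuous_on_subset[OF contf[OF cont] sub] by (rule integrable_continuous_real)
      \<comment> \<open>The source of the contraction factor: \<open>E' = 2 * K * E\<close>, so
        \<open>K\<close> times the integral of \<open>E\<close> is half of its increase.\<close>
      have hi: "((\<lambda>s. K * (\<delta> * (1/2) ^ k * E s)) has_integral
          \<delta> * (1/2) ^ Suc k * E t - \<delta> * (1/2) ^ Suc k * E a) {a..t}"
      proof (rule fundamental_theorem_of_calculus)
        show "((\<lambda>t. \<delta> * (1/2) ^ Suc k * E t) has_vector_derivative K * (\<delta> * (1/2) ^ k * E s)) (at s within {a..t})"
          for s
          unfolding E_def has_real_derivative_iff_has_vector_derivative[symmetric]
          by (auto intro!: derivative_eq_intros simp: field_simps)
      qed (use t in auto)
      have "\<bar>y (Suc (Suc k)) t - y (Suc k) t\<bar>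
          = \<bar>integral {a..t} (\<lambda>s. f s (y (Suc k) s) - f s (y k s))\<bar>"
        by (subst (1) ySuc, subst (2) ySuc) (simp add: \<Phi>_def integral_diff[OF int int])
      also have "\<dots> \<le> integral {a..t} (\<lambda>s. K * (\<delta> * (1/2) ^ k * E s))"
        unfolding real_norm_def[symmetric]
      proof (rule integral_norm_bound_integral)
        fix s assume "s \<in> {a..t}"
        then have s: "s \<in> {a..b}" using sub by auto
        have "\<bar>f s (y (Suc k) s) - f s (y k s)\<bar> \<le> K * \<bar>y (Suc k) s - y k s\<bar>"
          by (rule lip[OF s order_trans[OF 1[OF s] tube[OF s]] order_trans[OF IH1[OF s] tube[OF s]]])
        also have "\<dots> \<le> K * (\<delta> * (1/2) ^ k * E s)"
          using IH2[OF s] K by (intro mult_left_mono) auto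
        finally show "norm (f s (y (Suc k) s) - f s (y k s)) \<le> K * (\<delta> * (1/2) ^ k * E s)"
          by simp
      qed (use int hi in \<open>auto intro: integrable_diff\<close>)
      also have "\<dots> = \<delta> * (1/2) ^ Suc k * E t - \<delta> * (1/2) ^ Suc k * E a"
        using hi by (rule integral_unique)
      also have "\<dots> \<le> \<delta> * (1/2) ^ Suc k * E t"
        using \<delta> by (simp add: E_def)
      finally show ?thesis .
    qed
    show ?case using 1 2 by blast
  qed
  \<comment> \<open>The limit is written as a telescoping series so that the M-test with a geometric
    majorant gives uniform convergence of the iterates.\<close>
  define z where "z t = v t + (\<Sum>i. y (Suc i) t - y i t)" for t
  have "uniform_limit {a..b} (\<lambda>n t. \<Sum>i<n. y (Suc i) t - y i t) (\<lambda>t. \<Sum>i. y (Suc i) t - y i t) sequentially"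
  proof (rule Weierstrass_m_test)
    show "norm (y (Suc n) t - y n t) \<le> \<delta> * E b * (1/2) ^ n" if "t \<in> {a..b}" for n t
    proof -
      have "\<bar>y (Suc n) t - y n t\<bar> \<le> \<delta> * (1/2) ^ n * E t" using inv that by blast
      also have "\<dots> \<le> \<delta> * (1/2) ^ n * E b" using \<delta> Eb[OF that] by (intro mult_left_mono) auto
      finally show ?thesis by (simp add: mult_ac)
    qed
  qed (auto intro!: summable_mult summable_geometric)
  then have "uniform_limit {a..b} (\<lambda>n t. v t + (\<Sum>i<n. y (Suc i) t - y i t)) z sequentially"
    unfolding z_def by (intro uniform_limit_intros)
  moreover have "v t + (\<Sum>i<n. y (Suc i) t - y i t) = y n t" for n t
    by (induction n) (auto simp: y0)
  ultimately have lim: "uniform_limit {a..b} y z sequentially"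
    by simp
  have contz: "continuous_on {a..b} z"
    by (rule uniform_limit_theorem[OF _ lim]) (auto simp: cont)
  have ptw: "(\<lambda>k. y k t) \<longlonglongrightarrow> z t" if "t \<in> {a..b}" for t
    using tendsto_uniform_limitI[OF lim that] .
  have ybd: "\<bar>y k t - v t\<bar> \<le> 2 * \<delta> * E b" if "t \<in> {a..b}" for k t
  proof -
    have "\<bar>y k t - v t\<bar> \<le> 2 * \<delta> * (1 - (1/2) ^ k) * E t" using inv that by blast
    also have "\<dots> \<le> 2 * \<delta> * 1 * E b"
      using \<delta> Eb[OF that] E1[OF that] by (intro mult_mono) (auto simp: power_le_one)
    finally show ?thesis by simp
  qed
  have zbd: "\<bar>z t - v t\<bar> \<le> 2 * \<delta> * E b" if "t \<in> {a..b}" for t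
    by (rule tendsto_upperbound[OF tendsto_rabs[OF tendsto_diff[OF ptw[OF that] tendsto_const]]])
       (use ybd[OF that] in simp_all)
  \<comment> \<open>The limit stays in the closed tube too, so the Lipschitz bound carries uniform
    convergence over to the right-hand sides and the integrals converge.\<close>
  have limf: "uniform_limit {a..b} (\<lambda>k s. f s (y k s)) (\<lambda>s. f s (z s)) sequentially"
    unfolding uniform_limit_iff
  proof safe
    fix e :: real assume "0 < e"
    then have "\<forall>\<^sub>F k in sequentially. \<forall>s\<in>{a..b}. dist (y k s) (z s) < e / K"
      using lim K unfolding uniform_limit_iff by simp
    then show "\<forall>\<^sub>F k in sequentially. \<forall>s\<in>{a..b}. dist (f s (y k s)) (f s (z s)) < e"
    proof eventually_elim
      case (elim k)
      show ?case
      proof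
        fix s assume s: "s \<in> {a..b}"
        have "\<bar>f s (y k s) - f s (z s)\<bar> \<le> K * \<bar>y k s - z s\<bar>"
          using ybd[OF s, of k] zbd[OF s] R by (intro lip[OF s]) (auto simp: E_def)
        also have "\<dots> < e" using elim s K by (auto simp: dist_real_def field_simps)
        finally show "dist (f s (y k s)) (f s (z s)) < e" by (simp add: dist_real_def)
      qed
    qed
  qed
  have fixpt: "\<Phi> z t = z t" if t: "t \<in> {a..b}" for t
  proof -
    have sub: "{a..t} \<subseteq> {a..b}" using t by auto
    obtain I J where IJ: "\<And>k. ((\<lambda>s. f s (y k s)) has_integral I k) {a..t}"
      "((\<lambda>s. f s (z s)) has_integral J) {a..t}" "I \<longlonglongrightarrow> J"
      by (rule uniform_limit_integral[OF uniform_limit_on_subset[OF limf sub]])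
         (auto intro: continuous_on_subset[OF contf[OF cont] sub])
    have "(\<lambda>k. \<gamma> + I k) \<longlonglongrightarrow> \<gamma> + J" by (intro tendsto_intros IJ)
    moreover have "(\<lambda>k. \<gamma> + I k) = (\<lambda>k. y (Suc k) t)" "\<Phi> z t = \<gamma> + J"
      using integral_unique[OF IJ(1)] integral_unique[OF IJ(2)] by (auto simp: ySuc \<Phi>_def)
    ultimately show ?thesis
      using LIMSEQ_unique LIMSEQ_Suc[OF ptw[OF t]] by metis
  qed
  show thesis
  proof
    show "z a = \<gamma>" using fixpt[of a] ab by (simp add: \<Phi>_def)
    show "(z has_real_derivative f t (z t)) (at t within {a..b})" if "t \<in> {a..b}" for t
      unfolding has_real_derivative_iff_has_vector_derivative
      by (rule has_vector_derivative_transform[OF that fixpt[symmetric]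
            \<Phi>_der[OF contz that, unfolded has_real_derivative_iff_has_vector_derivative]])
    show "\<bar>z t - v t\<bar> \<le> 2 * \<delta> * exp (2 * K * (b - a))" if "t \<in> {a..b}" for t
      using zbd[OF that] by (simp add: E_def)
  qed
qed

text \<open>Gronwall in energy form: \<open>(z - w)^2 * exp (- 2 * K * s)\<close> has a nonpositive
  derivative and starts at 0. The Lipschitz bound is asked only along the two solutions.\<close>

lemma ode_unique:
  fixes f :: "real \<Rightarrow> real \<Rightarrow> real"
  assumes z: "\<And>t. t \<in> {a..b} \<Longrightarrow> (z has_real_derivative f t (z t)) (at t within {a..b})"
    and w: "\<And>t. t \<in> {a..b} \<Longrightarrow> (w has_real_derivative f t (w t)) (at t within {a..b})"
    and init: "z a = w a"
    and lip: "\<And>t. t \<in> {a..b} \<Longrightarrow> \<bar>f t (z t) - f t (w t)\<bar> \<le> K * \<bar>z t - w t\<bar>"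
    and t: "t \<in> {a..b}"
  shows "z t = w t"
proof -
  define g where "g s = (z s - w s)\<^sup>2 * exp (- 2 * K * s)" for s
  define g' where "g' s = (2 * ((z s - w s) * (f s (z s) - f s (w s))) - 2 * (K * (z s - w s)\<^sup>2)) * exp (- 2 * K * s)" for s
  have "(g' has_integral g t - g a) {a..t}"
  proof (rule fundamental_theorem_of_calculus)
    fix s assume s: "s \<in> {a..t}"
    have dz: "(z has_real_derivative f s (z s)) (at s within {a..b})"
      and dw: "(w has_real_derivative f s (w s)) (at s within {a..b})"
      using s t by (simp_all add: z w)
    have "(g has_real_derivative g' s) (at s within {a..b})"
      unfolding g_def g'_def
      by (rule derivative_eq_intros dz dw refl)+ (simp add: algebra_simps)
    then show "(g has_vector_derivative g' s) (at s within {a..t})"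
      unfolding has_real_derivative_iff_has_vector_derivative
      by (rule has_vector_derivative_within_subset) (use t in auto)
  qed (use t in auto)
  moreover have "g' s \<le> 0" if "s \<in> {a..t}" for s
  proof -
    have "(z s - w s) * (f s (z s) - f s (w s)) \<le> \<bar>z s - w s\<bar> * (K * \<bar>z s - w s\<bar>)"
      unfolding abs_mult[symmetric]
      by (rule order_trans[OF abs_ge_self], unfold abs_mult, rule mult_left_mono[OF lip]) (use that t in auto)
    also have "\<dots> = K * (z s - w s)\<^sup>2" by (simp add: power2_eq_square abs_mult_self_eq mult.left_commute)
    finally show ?thesis unfolding g'_def by (intro mult_nonpos_nonneg) (linarith, simp)
  qed
  ultimately have "g t - g a \<le> 0"
    using has_integral_le[OF _ has_integral_0, of g' "g t - g a" "{a..t}"] by blast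
  then have "(z t - w t)\<^sup>2 * exp (- 2 * K * t) \<le> 0" by (simp add: g_def init)
  then show ?thesis by (simp add: mult_le_0_iff)
qed

section \<open>Uniform estimates for continuously differentiable functions on compact sets\<close>

context
  fixes L :: "'a::euclidean_space \<Rightarrow> real" and L' :: "'a \<Rightarrow> 'a \<Rightarrow>\<^sub>L real"
  assumes der: "\<And>p. (L has_derivative blinfun_apply (L' p)) (at p)"
    and cont': "continuous_on UNIV L'"
begin

text \<open>The derivative is bounded on the compact ball, and the ball is convex, so the mean value
  inequality applies.\<close>

lemma C1_lipschitz_on_cball:
  obtains K where "0 < K"
    "\<And>u v. u \<in> cball 0 R \<Longrightarrow> v \<in> cball 0 R \<Longrightarrow> \<bar>L u - L v\<bar> \<le> K * norm (u - v)"
proof -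
  have "bounded (L' ` cball 0 R)"
    by (intro compact_imp_bounded compact_continuous_image continuous_on_subset[OF cont']) auto
  then obtain K where K: "0 < K" "\<And>p. p \<in> cball 0 R \<Longrightarrow> norm (L' p) \<le> K"
    by (auto simp: bounded_pos)
  have "\<bar>L u - L v\<bar> \<le> K * norm (u - v)" if "u \<in> cball 0 R" "v \<in> cball 0 R" for u v
    using differentiable_bound[of "cball 0 R" L "\<lambda>p. blinfun_apply (L' p)" K u v] that K(2)
    by (simp add: has_derivative_at_withinI[OF der] norm_blinfun.rep_eq)
  with K(1) that show thesis by blast
qed

text \<open>First-order expansion along a compact family of base points and directions. Uniform
  continuity of \<open>L'\<close> on one ball containing all the segments makes the remainder small
  uniformly in \<open>s\<close>.\<close>

lemma C1_uniform_remainder: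
  assumes "compact S" "continuous_on S p" "continuous_on S q" "0 < e"
  obtains d where "0 < d"
    "\<And>\<epsilon> s. \<bar>\<epsilon>\<bar> < d \<Longrightarrow> s \<in> S \<Longrightarrow>
       \<bar>L (p s + \<epsilon> *\<^sub>R q s) - L (p s) - \<epsilon> * L' (p s) (q s)\<bar> \<le> \<bar>\<epsilon>\<bar> * e"
proof -
  obtain P where P: "\<And>s. s \<in> S \<Longrightarrow> norm (p s) \<le> P"
    using compact_imp_bounded[OF compact_continuous_image[OF assms(2,1)]] by (auto simp: bounded_iff)
  obtain Q where Q: "0 < Q" "\<And>s. s \<in> S \<Longrightarrow> norm (q s) \<le> Q"
    using compact_imp_bounded[OF compact_continuous_image[OF assms(3,1)]] by (auto simp: bounded_pos)
  have "uniformly_continuous_on (cball 0 (P + Q)) L'"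
    by (intro compact_uniformly_continuous continuous_on_subset[OF cont']) auto
  moreover have "0 < e / Q" using assms(4) Q(1) by simp
  ultimately obtain r where r: "0 < r" "\<And>u v. u \<in> cball 0 (P + Q) \<Longrightarrow> v \<in> cball 0 (P + Q) \<Longrightarrow>
      dist v u < r \<Longrightarrow> dist (L' v) (L' u) < e / Q"
    by (rule uniformly_continuous_onE) blast
  show thesis
  \<comment> \<open>The bound 1 keeps the segments in the ball of radius \<open>P + Q\<close>; the
    bound \<open>r / Q\<close> keeps them within \<open>r\<close> of the base point, where
    \<open>L'\<close> varies by at most \<open>e / Q\<close>.\<close>
  proof (rule that[of "min 1 (r / Q)"])
    fix \<epsilon> s assume \<epsilon>: "\<bar>\<epsilon>\<bar> < min 1 (r / Q)" and s: "s \<in> S"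
    let ?u = "p s" and ?v = "p s + \<epsilon> *\<^sub>R q s"
    have seg: "norm (x - ?u) \<le> \<bar>\<epsilon>\<bar> * Q" if x: "x \<in> closed_segment ?u ?v" for x
    proof -
      obtain \<theta> where \<theta>: "0 \<le> \<theta>" "\<theta> \<le> 1" "x = (1 - \<theta>) *\<^sub>R ?u + \<theta> *\<^sub>R ?v"
        using x unfolding in_segment(1) by blast
      have "x - ?u = \<theta> *\<^sub>R \<epsilon> *\<^sub>R q s"
        unfolding \<theta>(3) by (simp add: scaleR_diff_left scaleR_add_right)
      then have "norm (x - ?u) = \<theta> * (\<bar>\<epsilon>\<bar> * norm (q s))"
        using \<theta>(1) by (simp add: abs_mult)
      also have "\<dots> \<le> 1 * (\<bar>\<epsilon>\<bar> * Q)"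
        by (intro mult_mono \<theta> Q(2)[OF s]) auto
      finally show ?thesis by simp
    qed
    have "norm (L ?v - L ?u - L' ?u (?v - ?u)) \<le> norm (?v - ?u) * (e / Q)"
    proof (rule differentiable_bound_linearization[where S = "closed_segment ?u ?v" and f' = "\<lambda>x. blinfun_apply (L' x)"])
      show "?u + t *\<^sub>R (?v - ?u) \<in> closed_segment ?u ?v" if "t \<in> {0..1}" for t
      proof -
        have "?u + t *\<^sub>R (?v - ?u) = (1 - t) *\<^sub>R ?u + t *\<^sub>R ?v" by (simp add: algebra_simps)
        with that show ?thesis unfolding in_segment by auto
      qed
      fix x assume x: "x \<in> closed_segment ?u ?v"
      show "(L has_derivative blinfun_apply (L' x)) (at x within closed_segment ?u ?v)"
        by (rule has_derivative_at_withinI[OF der])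
      have 1: "\<bar>\<epsilon>\<bar> * Q \<le> 1 * Q" and 2: "\<bar>\<epsilon>\<bar> * Q < r"
        using \<epsilon> Q(1) by (auto simp: field_simps)
      have "norm x \<le> norm ?u + norm (x - ?u)" by (rule norm_triangle_sub)
      then have "norm x \<le> P + Q"
        using seg[OF x] 1 P[OF s] by linarith
      then have "x \<in> cball 0 (P + Q)" "?u \<in> cball 0 (P + Q)" "dist x ?u < r"
        using le_less_trans[OF seg[OF x] 2] P[OF s] Q(1) by (simp_all add: dist_norm)
      then have "norm (L' x - L' ?u) \<le> e / Q" using r(2)[of ?u x] by (simp add: dist_norm)
      moreover have "blinfun_apply (L' x) - blinfun_apply (L' ?u) = blinfun_apply (L' x - L' ?u)"
        by (auto simp: blinfun.diff_left)
      ultimately show "onorm (blinfun_apply (L' x) - blinfun_apply (L' ?u)) \<le> e / Q"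
        by (simp add: norm_blinfun.rep_eq)
    qed simp
    also have "norm (?v - ?u) * (e / Q) \<le> (\<bar>\<epsilon>\<bar> * Q) * (e / Q)"
      by (rule mult_right_mono[OF seg]) (use assms(4) Q(1) in auto)
    finally show "\<bar>L ?v - L ?u - \<epsilon> * L' ?u (q s)\<bar> \<le> \<bar>\<epsilon>\<bar> * e"
      using Q(1) by (simp add: blinfun.scaleR_right)
  qed (use r(1) Q(1) in simp)
qed

end

section \<open>Perturbation of the initial value problem\<close>

lemma continuous_on_Icc_norm_bound:
  fixes f :: "real \<Rightarrow> 'a::real_normed_vector"
  assumes "continuous_on {a..b} f"
  obtains B where "\<And>s. s \<in> {a..b} \<Longrightarrow> norm (f s) \<le> B"
  using compact_imp_bounded[OF compact_continuous_image[OF assms compact_Icc]]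
  unfolding bounded_iff by (meson imageI)

context
  fixes L :: "real \<times> (real ^ 'm::finite) \<times> real \<Rightarrow> real"
    and L' :: "real \<times> (real ^ 'm) \<times> real \<Rightarrow> (real \<times> (real ^ 'm) \<times> real) \<Rightarrow>\<^sub>L real"
  assumes der: "\<And>p. (L has_derivative blinfun_apply (L' p)) (at p)"
    and cont': "continuous_on UNIV L'"
begin

lemma continuous_on_L:
  "continuous_on S p \<Longrightarrow> continuous_on S (\<lambda>s. L (p s))"
  by (rule continuous_on_compose2[OF _ _ subset_UNIV])
     (auto intro!: has_derivative_continuous_on[OF has_derivative_at_withinI[OF der]])

lemma continuous_on_L':
  "continuous_on S p \<Longrightarrow> continuous_on S (\<lambda>s. L' (p s))"
  by (rule continuous_on_compose2[OF cont' _ subset_UNIV])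

text \<open>Existence and differentiability in \<epsilon> come together:
  \<open>z + \<epsilon> \<zeta>\<close> is an approximate solution of the perturbed problem, and
  Picard iteration started there ends at an exact one.\<close>

lemma ivp_perturbation:
  assumes ab: "a < b" and contY: "continuous_on {a..b} Y" and contH: "continuous_on {a..b} H"
    and z: "\<And>t. t \<in> {a..b} \<Longrightarrow> (z has_real_derivative L (t, Y t, z t)) (at t within {a..b})"
    and \<zeta>: "\<And>t. t \<in> {a..b} \<Longrightarrow>
      (\<zeta> has_real_derivative L' (t, Y t, z t) (0, H t, \<zeta> t)) (at t within {a..b})"
    and \<zeta>a: "\<zeta> a = 0" and e: "0 < e"
  obtains d where "0 < d" "\<And>\<epsilon>. \<bar>\<epsilon>\<bar> < d \<Longrightarrow> \<exists>w. w a = z a \<and>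
      (\<forall>t\<in>{a..b}. (w has_real_derivative L (t, Y t + \<epsilon> *\<^sub>R H t, w t)) (at t within {a..b})) \<and>
      \<bar>w b - (z b + \<epsilon> * \<zeta> b)\<bar> \<le> \<bar>\<epsilon>\<bar> * e"
proof -
  note continuous_on_L [continuous_intros] continuous_on_L' [continuous_intros]
  have contz: "continuous_on {a..b} z" and cont\<zeta>: "continuous_on {a..b} \<zeta>"
    by (rule DERIV_continuous_on, erule z, rule DERIV_continuous_on, erule \<zeta>)
  define p where "p t = (t, Y t, z t)" for t
  define q where "q t = (0 :: real, H t, \<zeta> t)" for t
  have contp: "continuous_on {a..b} p" and contq: "continuous_on {a..b} q"
    unfolding p_def q_def by (intro continuous_intros contY contH contz cont\<zeta>)+
  obtain P where P: "\<And>s. s \<in> {a..b} \<Longrightarrow> norm (p s) \<le> P"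
    using continuous_on_Icc_norm_bound[OF contp] by metis
  obtain Q where Q: "\<And>s. s \<in> {a..b} \<Longrightarrow> norm (q s) \<le> Q"
    using continuous_on_Icc_norm_bound[OF contq] by metis
  obtain K where K: "0 < K" "\<And>u v. u \<in> cball 0 (P + Q + 1) \<Longrightarrow> v \<in> cball 0 (P + Q + 1) \<Longrightarrow>
      \<bar>L u - L v\<bar> \<le> K * norm (u - v)"
    using C1_lipschitz_on_cball[OF der cont'] by metis
  \<comment> \<open>Chosen so that a defect rate \<open>\<bar>\<epsilon>\<bar> * (e / C)\<close>,
    integrated over the interval and amplified by the Picard bound, becomes exactly
    \<open>\<bar>\<epsilon>\<bar> * e\<close>.\<close>
  define C where "C = 2 * exp (2 * K * (b - a)) * (b - a)"
  have C: "0 < C" using ab by (simp add: C_def)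
  obtain d where d: "0 < d" "\<And>\<epsilon> s. \<bar>\<epsilon>\<bar> < d \<Longrightarrow> s \<in> {a..b} \<Longrightarrow>
       \<bar>L (p s + \<epsilon> *\<^sub>R q s) - L (p s) - \<epsilon> * L' (p s) (q s)\<bar> \<le> \<bar>\<epsilon>\<bar> * (e / C)"
    using C1_uniform_remainder[OF der cont' compact_Icc contp contq divide_pos_pos[OF e C]] by metis
  show thesis
  \<comment> \<open>The bound 1 keeps \<open>\<epsilon> q\<close> below \<open>Q\<close>, and
    \<open>1 / e\<close> keeps the final error below the tube radius 1; this explains the ball
    radius \<open>P + Q + 1\<close>.\<close>
  proof (rule that[of "min d (min 1 (1 / e))"])
    show "0 < min d (min 1 (1 / e))" using d(1) e by simp
    fix \<epsilon> assume eps: "\<bar>\<epsilon>\<bar> < min d (min 1 (1 / e))"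
    have eps_e: "\<bar>\<epsilon>\<bar> * e \<le> 1" using eps e by (simp add: field_simps)
    define v where "v t = z t + \<epsilon> * \<zeta> t" for t
    \<comment> \<open>Separates the expansion point from the vertical offset \<open>y - v t\<close>:
      the offset is at most 1 in the tube and vanishes for the defect, where
      \<open>y = v t\<close>.\<close>
    have split: "(t, Y t + \<epsilon> *\<^sub>R H t, y) = p t + \<epsilon> *\<^sub>R q t + (0, 0, y - v t)" for t y
      by (simp add: p_def q_def v_def)
    have ball: "(t, Y t + \<epsilon> *\<^sub>R H t, y) \<in> cball 0 (P + Q + 1)"
      if t: "t \<in> {a..b}" and y: "\<bar>y - v t\<bar> \<le> 1" for t y
    proof -
      have "norm (\<epsilon> *\<^sub>R q t) \<le> 1 * Q"
        unfolding norm_scaleR using eps Q[OF t] by (intro mult_mono) auto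
      moreover have "norm (0 :: real, 0 :: real ^ 'm, y - v t) \<le> 1"
        using y by (simp add: norm_Pair)
      ultimately have "norm (p t + \<epsilon> *\<^sub>R q t + (0, 0, y - v t)) \<le> P + Q + 1"
        using P[OF t] by (intro norm_triangle_mono) auto
      then show ?thesis unfolding split by simp
    qed
    define \<delta> where "\<delta> = \<bar>\<epsilon>\<bar> * (e / C) * (b - a)"
    have \<delta>: "0 \<le> \<delta>" using e C ab by (simp add: \<delta>_def)
    have \<delta>C: "2 * \<delta> * exp (2 * K * (b - a)) = \<bar>\<epsilon>\<bar> * e"
      using ab by (simp add: \<delta>_def C_def)
    have contv: "continuous_on {a..b} v"
      unfolding v_def by (intro continuous_intros contz cont\<zeta>)
    have contf: "continuous_on {a..b} (\<lambda>s. L (s, Y s + \<epsilon> *\<^sub>R H s, y s))" if "continuous_on {a..b} y" for y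
      by (intro continuous_intros contY contH that)
    have lip: "\<bar>L (s, Y s + \<epsilon> *\<^sub>R H s, y) - L (s, Y s + \<epsilon> *\<^sub>R H s, y')\<bar> \<le> K * \<bar>y - y'\<bar>"
      if "s \<in> {a..b}" "\<bar>y - v s\<bar> \<le> 1" "\<bar>y' - v s\<bar> \<le> 1" for s y y'
      using K(2)[OF ball[OF that(1,2)] ball[OF that(1,3)]] by (simp add: norm_Pair)
    have defect: "\<bar>z a + integral {a..t} (\<lambda>s. L (s, Y s + \<epsilon> *\<^sub>R H s, v s)) - v t\<bar> \<le> \<delta>"
      if t: "t \<in> {a..b}" for t
    proof -
      have sub: "{a..t} \<subseteq> {a..b}" using t by auto
      let ?r = "\<lambda>s. L (p s + \<epsilon> *\<^sub>R q s) - L (p s) - \<epsilon> * L' (p s) (q s)"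
      have hv: "((\<lambda>s. L (p s) + \<epsilon> * L' (p s) (q s)) has_integral v t - v a) {a..t}"
      proof (rule fundamental_theorem_of_calculus)
        fix s assume "s \<in> {a..t}"
        then have s: "s \<in> {a..b}" using t by auto
        have "(v has_real_derivative L (p s) + \<epsilon> * L' (p s) (q s)) (at s within {a..b})"
          unfolding v_def p_def q_def
          by (rule derivative_eq_intros z[OF s] \<zeta>[OF s] refl)+ simp
        then show "(v has_vector_derivative L (p s) + \<epsilon> * L' (p s) (q s)) (at s within {a..t})"
          unfolding has_real_derivative_iff_has_vector_derivative
          by (rule has_vector_derivative_within_subset) (rule sub)
      qed (use t in auto)
      have hf: "(\<lambda>s. L (s, Y s + \<epsilon> *\<^sub>R H s, v s)) integrable_on {a..t}"
        by (intro integrable_continuous_real continuous_on_subset[OF contf[OF contv] sub])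
      have "((\<lambda>s. L (s, Y s + \<epsilon> *\<^sub>R H s, v s) - (L (p s) + \<epsilon> * L' (p s) (q s))) has_integral
          integral {a..t} (\<lambda>s. L (s, Y s + \<epsilon> *\<^sub>R H s, v s)) - (v t - v a)) {a..t}"
        by (rule has_integral_diff[OF integrable_integral[OF hf] hv])
      moreover have "(\<lambda>s. L (s, Y s + \<epsilon> *\<^sub>R H s, v s) - (L (p s) + \<epsilon> * L' (p s) (q s))) = ?r"
        by (simp add: split diff_diff_eq flip: zero_prod_def)
      ultimately have "integral {a..t} ?r = z a + integral {a..t} (\<lambda>s. L (s, Y s + \<epsilon> *\<^sub>R H s, v s)) - v t"
        using \<zeta>a by (simp add: integral_unique v_def)
      moreover have "norm (integral {a..t} ?r) \<le> \<bar>\<epsilon>\<bar> * (e / C) * (t - a)"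
      proof (rule integral_bound)
        show "continuous_on {a..t} ?r"
          by (intro continuous_intros continuous_on_subset[OF contp sub] continuous_on_subset[OF contq sub])
        show "norm (?r s) \<le> \<bar>\<epsilon>\<bar> * (e / C)" if "s \<in> {a..t}" for s
          using d(2)[of \<epsilon> s] eps that t by simp
      qed (use t in auto)
      moreover have "\<bar>\<epsilon>\<bar> * (e / C) * (t - a) \<le> \<delta>"
        unfolding \<delta>_def using t e C by (intro mult_left_mono) auto
      ultimately show ?thesis by simp
    qed
    obtain w where w: "w a = z a"
      "\<And>t. t \<in> {a..b} \<Longrightarrow> (w has_real_derivative L (t, Y t + \<epsilon> *\<^sub>R H t, w t)) (at t within {a..b})"
      "\<And>t. t \<in> {a..b} \<Longrightarrow> \<bar>w t - v t\<bar> \<le> 2 * \<delta> * exp (2 * K * (b - a))"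
      by (rule picard_near_approximate_solution[where f = "\<lambda>t y. L (t, Y t + \<epsilon> *\<^sub>R H t, y)" and R = 1,
            OF less_imp_le[OF ab] K(1) \<delta> contv contf lip defect])
         (simp_all add: \<delta>C eps_e that)
    have "\<bar>w b - (z b + \<epsilon> * \<zeta> b)\<bar> \<le> \<bar>\<epsilon>\<bar> * e"
      using w(3)[of b] ab unfolding \<delta>C v_def by simp
    with w(1,2) show "\<exists>w. w a = z a \<and>
      (\<forall>t\<in>{a..b}. (w has_real_derivative L (t, Y t + \<epsilon> *\<^sub>R H t, w t)) (at t within {a..b})) \<and>
      \<bar>w b - (z b + \<epsilon> * \<zeta> b)\<bar> \<le> \<bar>\<epsilon>\<bar> * e"
      by blast
  qed
qed

text \<open>Justifies the definite description in \<open>z_of\<close>: two solutions run inside a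
  common ball, where \<open>L\<close> is Lipschitz, so they agree on the interval.\<close>

lemma z_of_eq:
  assumes contx: "continuous_on {a..b} (\<lambda>t. \<chi> i. nderiv_on {a..b} (idx i) x t)"
    and z: "solves_ivp idx L a b \<gamma> x z" and t: "t \<in> {a..b}"
  shows "z_of idx L a b \<gamma> x t = z t"
proof -
  have "w t = z t" if w: "solves_ivp idx L a b \<gamma> x w" for w
  proof -
    have cont: "continuous_on {a..b} (bracket idx a b x y)" if "solves_ivp idx L a b \<gamma> x y" for y
    proof -
      have "continuous_on {a..b} y"
        using that unfolding solves_ivp_def by (intro DERIV_continuous_on) blast
      then show ?thesis
        unfolding bracket_def by (intro continuous_intros contx)
    qed
    obtain Rz where Rz: "\<And>s. s \<in> {a..b} \<Longrightarrow> norm (bracket idx a b x z s) \<le> Rz"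
      using continuous_on_Icc_norm_bound[OF cont[OF z]] by metis
    obtain Rw where Rw: "\<And>s. s \<in> {a..b} \<Longrightarrow> norm (bracket idx a b x w s) \<le> Rw"
      using continuous_on_Icc_norm_bound[OF cont[OF w]] by metis
    define R where "R = max Rz Rw"
    have R: "bracket idx a b x z s \<in> cball 0 R" "bracket idx a b x w s \<in> cball 0 R" if "s \<in> {a..b}" for s
      using Rz[OF that] Rw[OF that] by (simp_all add: R_def)
    obtain K where K: "\<And>u v. u \<in> cball 0 R \<Longrightarrow> v \<in> cball 0 R \<Longrightarrow> \<bar>L u - L v\<bar> \<le> K * norm (u - v)"
      using C1_lipschitz_on_cball[OF der cont'] by metis
    show ?thesis
    \<comment> \<open>\<open>bracket\<close> reads its function argument only at the current time,
      so a constant function turns it into a scalar right-hand side.\<close>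
    proof (rule ode_unique[where f = "\<lambda>s y. L (bracket idx a b x (\<lambda>_. y) s)" and K = K, OF _ _ _ _ t])
      show "\<bar>L (bracket idx a b x (\<lambda>_. w s) s) - L (bracket idx a b x (\<lambda>_. z s) s)\<bar> \<le> K * \<bar>w s - z s\<bar>"
        if "s \<in> {a..b}" for s
        using K[OF R(2)[OF that] R(1)[OF that]] by (simp add: bracket_def norm_Pair)
    next
      fix s assume "s \<in> {a..b}"
      then show "(w has_real_derivative L (bracket idx a b x (\<lambda>_. w s) s)) (at s within {a..b})"
        "(z has_real_derivative L (bracket idx a b x (\<lambda>_. z s) s)) (at s within {a..b})"
        using z w unfolding solves_ivp_def bracket_def by blast+
    next
      show "w a = z a" using z w by (simp add: solves_ivp_def)
    qed
  qed
  then show ?thesis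
    unfolding z_of_def using z by (intro the_equality) blast+
qed

end

section \<open>Partial derivatives as values of the Frechet derivative\<close>

context
  fixes L :: "real \<times> (real ^ 'm::finite) \<times> real \<Rightarrow> real"
    and L' :: "real \<times> (real ^ 'm) \<times> real \<Rightarrow> (real \<times> (real ^ 'm) \<times> real) \<Rightarrow>\<^sub>L real"
  assumes der: "\<And>p. (L has_derivative blinfun_apply (L' p)) (at p)"
begin

lemma partial_z_eq: "partial_z L p = L' p (0, 0, 1)"
proof -
  obtain t y z where p: "p = (t, y, z)" by (cases p)
  have "((\<lambda>s. (t, y, s)) has_derivative (\<lambda>h. (0, 0, h))) (at z)"
    by (intro has_derivative_Pair has_derivative_const has_derivative_ident)
  from has_derivative_compose[OF this der]
  have "((\<lambda>s. L (t, y, s)) has_derivative (\<lambda>h. L' p (0, 0, h))) (at z)"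
    by (simp add: p)
  moreover have "(\<lambda>h. L' p (0, 0, h)) = (*) (L' p (0, 0, 1))"
  proof
    show "L' p (0, 0, h) = L' p (0, 0, 1) * h" for h
      using blinfun.scaleR_right[of "L' p" h "(0, 0, 1)"] by simp
  qed
  ultimately have "((\<lambda>s. L (t, y, s)) has_field_derivative L' p (0, 0, 1)) (at z)"
    by (simp only: has_field_derivative_def)
  then show ?thesis by (simp add: partial_z_def p DERIV_imp_deriv)
qed

lemma partial_x_eq:
  assumes "inj idx"
  shows "partial_x idx L (idx i) p = L' p (0, axis i 1, 0)"
proof -
  obtain t y z where p: "p = (t, y, z)" by (cases p)
  \<comment> \<open>By injectivity of \<open>idx\<close>, replacing the variable of order
    \<open>idx i\<close> is a motion along the single axis \<open>i\<close>, so the chain rule along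
    a line applies.\<close>
  have eq: "(\<chi> k. if idx k = idx i then s else y $ k) = y + (s - y $ i) *\<^sub>R axis i 1" for s
    by (simp add: vec_eq_iff axis_def inj_eq[OF assms])
  have "((\<lambda>s. y + (s - y $ i) *\<^sub>R axis i 1) has_derivative (\<lambda>h. h *\<^sub>R axis i 1)) (at (y $ i))"
    by (rule derivative_eq_intros refl)+ simp
  then have "((\<lambda>s. (t, y + (s - y $ i) *\<^sub>R axis i 1, z)) has_derivative (\<lambda>h. (0, h *\<^sub>R axis i 1, 0))) (at (y $ i))"
    by (intro has_derivative_Pair has_derivative_const)
  from has_derivative_compose[OF this der]
  have "((\<lambda>s. L (t, y + (s - y $ i) *\<^sub>R axis i 1, z)) has_derivative (\<lambda>h. L' p (0, h *\<^sub>R axis i 1, 0))) (at (y $ i))"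
    by (simp add: p)
  moreover have "(\<lambda>h. L' p (0, h *\<^sub>R axis i 1, 0)) = (*) (L' p (0, axis i 1, 0))"
  proof
    show "L' p (0, h *\<^sub>R axis i 1, 0) = L' p (0, axis i 1, 0) * h" for h
      using blinfun.scaleR_right[of "L' p" h "(0, axis i 1, 0)"] by simp
  qed
  ultimately have "((\<lambda>s. L (t, y + (s - y $ i) *\<^sub>R axis i 1, z)) has_field_derivative L' p (0, axis i 1, 0)) (at (y $ i))"
    by (simp only: has_field_derivative_def)
  then show ?thesis by (simp add: partial_x_def p eq inv_f_f[OF assms] DERIV_imp_deriv)
qed

lemma sum_partial_x:
  assumes "bij_betw idx UNIV {..n}"
  shows "(\<Sum>j\<le>n. partial_x idx L j p * h j) = L' p (0, \<chi> i. h (idx i), 0)"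
proof -
  have inj: "inj idx" using assms by (rule bij_betw_imp_inj_on)
  have "(\<Sum>j\<le>n. partial_x idx L j p * h j) = (\<Sum>i\<in>UNIV. partial_x idx L (idx i) p * h (idx i))"
    using sum.reindex_bij_betw[OF assms, of "\<lambda>j. partial_x idx L j p * h j"] by simp
  also have "\<dots> = (\<Sum>i\<in>UNIV. L' p (h (idx i) *\<^sub>R (0, axis i 1, 0)))"
    by (simp add: partial_x_eq[OF inj] blinfun.scaleR_right mult.commute del: scaleR_Pair)
  also have "\<dots> = L' p (\<Sum>i\<in>UNIV. h (idx i) *\<^sub>R (0, axis i 1, 0))"
    by (simp add: blinfun.sum_right)
  also have "(\<Sum>i\<in>UNIV. h (idx i) *\<^sub>R (0 :: real, axis i 1 :: real ^ 'm, 0 :: real)) = (0, \<chi> i. h (idx i), 0)"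
    by (simp add: prod_eq_iff fst_sum snd_sum vec_eq_iff axis_def if_distrib sum.delta cong: if_cong)
  finally show ?thesis .
qed

end

section \<open>Integration by parts and the du Bois-Reymond lemma\<close>

lemma higher_pderiv_has_real_derivative:
  "((\<lambda>s. poly ((pderiv ^^ i) p) s) has_real_derivative poly ((pderiv ^^ Suc i) p) t) (at t within S)"
  using DERIV_subset[OF poly_DERIV[of "(pderiv ^^ i) p" t]] by simp

text \<open>Repeated integration by parts as one telescoping sum: the product rule turns each
  boundary term into a difference of neighbours, and only the two extreme products remain. The
  fundamental theorem for the Henstock-Kurzweil integral covers a possibly discontinuous
  derivative.\<close>

lemma integration_by_parts_higher:
  fixes f :: "real \<Rightarrow> real" and \<eta> :: "real poly"
  assumes ab: "a < b" and td: "times_differentiable_on n f {a..b}" and j: "j \<le> n"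
  defines "B \<equiv> \<lambda>t. \<Sum>i<j. (-1) ^ i * nderiv_on {a..b} i f t * poly ((pderiv ^^ (j - 1 - i)) \<eta>) t"
  shows "((\<lambda>t. f t * poly ((pderiv ^^ j) \<eta>) t - (-1) ^ j * nderiv_on {a..b} j f t * poly \<eta> t)
    has_integral B b - B a) {a..b}"
proof (rule fundamental_theorem_of_calculus)
  fix t assume t: "t \<in> {a..b}"
  let ?f = "\<lambda>i. nderiv_on {a..b} i f t" and ?e = "\<lambda>i. poly ((pderiv ^^ i) \<eta>) t"
  let ?T = "\<lambda>i. (-1) ^ i * ?f i * ?e (j - i)"
  have "((\<lambda>t. (-1) ^ i * nderiv_on {a..b} i f t * poly ((pderiv ^^ (j - 1 - i)) \<eta>) t)
      has_real_derivative ?T i - ?T (Suc i)) (at t within {a..b})" if i: "i < j" for i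
  proof -
    have 1: "Suc (j - 1 - i) = j - i" "j - Suc i = j - 1 - i" using i by auto
    have df: "(nderiv_on {a..b} i f has_real_derivative ?f (Suc i)) (at t within {a..b})"
      using has_derivative_nderiv_on[OF td _ t] i j by simp
    have de: "((\<lambda>s. poly ((pderiv ^^ (j - 1 - i)) \<eta>) s) has_real_derivative ?e (j - i)) (at t within {a..b})"
      using higher_pderiv_has_real_derivative[of "j - 1 - i" \<eta> t] unfolding 1 .
    show ?thesis
      by (rule derivative_eq_intros df de refl)+ (simp add: algebra_simps)
  qed
  then have "(B has_real_derivative (\<Sum>i<j. ?T i - ?T (Suc i))) (at t within {a..b})"
    unfolding B_def by (intro DERIV_sum) simp
  also have "(\<Sum>i<j. ?T i - ?T (Suc i)) = ?f 0 * ?e j - (-1) ^ j * ?f j * ?e 0"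
    using sum_lessThan_telescope'[of ?T j] by simp
  finally show "(B has_vector_derivative f t * ?e j - (-1) ^ j * ?f j * poly \<eta> t) (at t within {a..b})"
    by (simp add: has_real_derivative_iff_has_vector_derivative)
qed (use ab in auto)

text \<open>With the weight \<open>W = ((t - a) (t - b))\<^sup>2\<^sup>n\<close>, every polynomial \<open>p\<close> with
  \<open>\<integral> W p = 0\<close> gives an admissible \<open>\<eta>\<close> with \<open>\<eta>' = W p\<close>. So \<open>G - c\<close>, for \<open>c\<close> the \<open>W\<close>-weighted mean
  of \<open>G\<close>, is \<open>W\<close>-orthogonal to all polynomials and vanishes by Weierstrass approximation.\<close>

lemma du_bois_reymond:
  fixes G :: "real \<Rightarrow> real"
  assumes ab: "a < b" and contG: "continuous_on {a..b} G"
    and test: "\<And>\<eta>. (\<And>k. k < n \<Longrightarrow> poly ((pderiv ^^ k) \<eta>) a = 0) \<Longrightarrow>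
        (\<And>k. k < n \<Longrightarrow> poly ((pderiv ^^ k) \<eta>) b = 0) \<Longrightarrow>
        integral {a..b} (\<lambda>t. G t * poly (pderiv \<eta>) t) = 0"
  obtains c where "\<And>t. t \<in> {a..b} \<Longrightarrow> G t = c"
proof -
  define W where "W = [:- a, 1:] ^ (2 * n) * [:- b, 1:] ^ (2 * n)"
  have W: "poly W t = ((t - a)\<^sup>2 * (t - b)\<^sup>2) ^ n" for t
    by (simp add: W_def power_mult power_mult_distrib)
  have W0: "0 \<le> poly W t" for t by (simp add: W)
  have int: "f integrable_on {a..b}" if "continuous_on {a..b} f" for f :: "real \<Rightarrow> real"
    using that by (rule integrable_continuous_real)
  have GW0: "integral {a..b} (\<lambda>t. G t * (poly W t * poly p t)) = 0"
    if p: "integral {a..b} (\<lambda>t. poly W t * poly p t) = 0" for p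
  proof -
    obtain \<eta> where \<eta>: "pderiv \<eta> = W * p" "poly \<eta> a = 0" by (rule pderiv_surj)
    have "((\<lambda>t. poly (W * p) t) has_integral poly \<eta> b - poly \<eta> a) {a..b}"
    proof (rule fundamental_theorem_of_calculus)
      show "(poly \<eta> has_vector_derivative poly (W * p) t) (at t within {a..b})" for t
        using higher_pderiv_has_real_derivative[of 0 \<eta> t]
        by (simp add: \<eta>(1) has_real_derivative_iff_has_vector_derivative)
    qed (use ab in simp)
    then have \<eta>b: "poly \<eta> b = 0" using p \<eta>(2) by (simp add: integral_unique)
    have "[:- a, 1:] ^ n dvd W" "[:- b, 1:] ^ n dvd W"
      unfolding W_def by (rule dvd_mult2 dvd_mult, rule le_imp_power_dvd, simp)+
    then have dvd: "[:- a, 1:] ^ n dvd W * p" "[:- b, 1:] ^ n dvd W * p"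
      by (simp_all add: dvd_mult2)
    \<comment> \<open>Order 0 is the endpoint value of the antiderivative; higher orders are
      derivatives of \<open>W * p\<close>, in which the endpoint is a root of multiplicity at least
      \<open>n\<close>.\<close>
    have "poly ((pderiv ^^ k) \<eta>) c = 0" if "k < n" "poly \<eta> c = 0" "[:- c, 1:] ^ n dvd W * p" for k c
    proof (cases k)
      case (Suc l)
      then have "(pderiv ^^ k) \<eta> = (pderiv ^^ l) (W * p)" by (simp add: funpow_Suc_right \<eta>(1) del: funpow.simps)
      then show ?thesis using higher_pderiv_root[OF that(3), of l] that(1) Suc by simp
    qed (use that in simp)
    then have "integral {a..b} (\<lambda>t. G t * poly (pderiv \<eta>) t) = 0"
      using \<eta>(2) \<eta>b dvd by (intro test) blast+
    then show ?thesis by (simp add: \<eta>(1))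
  qed
  define w where "w = integral {a..b} (poly W)"
  have "w \<noteq> 0"
  proof
    assume "w = 0"
    then have "\<forall>t\<in>{a..b}. poly W t = 0"
      unfolding w_def using W0
      by (subst integral_eq_0_iff[symmetric]) (auto intro!: continuous_intros ab)
    moreover have "(a + b) / 2 \<in> {a..b}" "poly W ((a + b) / 2) \<noteq> 0" using ab by (auto simp: W)
    ultimately show False by blast
  qed
  define c where "c = integral {a..b} (\<lambda>t. G t * poly W t) / w"
  define D where "D t = G t - c" for t
  have contD: "continuous_on {a..b} D" unfolding D_def by (intro continuous_intros contG)
  have orth: "integral {a..b} (\<lambda>t. poly W t * D t * poly p t) = 0" for p
  proof -
    let ?I = "integral {a..b} (\<lambda>t. poly W t * poly p t)"
    \<comment> \<open>Subtracting the constant \<open>m\<close> gives \<open>p\<close> weighted mean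
      0, so \<open>GW0\<close> applies to the difference.\<close>
    define m where "m = ?I / w"
    have "integral {a..b} (\<lambda>t. poly W t * poly (p - [:m:]) t)
        = integral {a..b} (\<lambda>t. poly W t * poly p t - m * poly W t)"
      by (simp add: algebra_simps)
    also have "\<dots> = ?I - m * w"
      unfolding w_def by (subst integral_diff) (auto intro!: int continuous_intros)
    also have "\<dots> = 0" using \<open>w \<noteq> 0\<close> by (simp add: m_def)
    finally have "0 = integral {a..b} (\<lambda>t. G t * (poly W t * poly (p - [:m:]) t))"
      by (rule GW0[symmetric])
    also have "\<dots> = integral {a..b} (\<lambda>t. G t * poly W t * poly p t - m * (G t * poly W t))"
      by (simp add: algebra_simps)
    also have "\<dots> = integral {a..b} (\<lambda>t. G t * poly W t * poly p t) - m * (c * w)"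
      using \<open>w \<noteq> 0\<close> unfolding c_def
      by (subst integral_diff) (auto intro!: int continuous_intros contG)
    finally have 1: "integral {a..b} (\<lambda>t. G t * poly W t * poly p t) = c * ?I"
      using \<open>w \<noteq> 0\<close> by (simp add: m_def)
    have "integral {a..b} (\<lambda>t. poly W t * D t * poly p t)
        = integral {a..b} (\<lambda>t. G t * poly W t * poly p t - c * (poly W t * poly p t))"
      by (simp add: D_def algebra_simps)
    also have "\<dots> = 0"
      using 1 by (subst integral_diff) (auto intro!: int continuous_intros contG)
    finally show ?thesis .
  qed
  define M where "M = integral {a..b} (\<lambda>t. poly W t * \<bar>D t\<bar>)"
  \<comment> \<open>One factor \<open>D\<close> is replaced by a polynomial within \<open>e\<close>;
    the polynomial part integrates to 0 by \<open>orth\<close>, leaving at most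
    \<open>e * M\<close>.\<close>
  have small: "integral {a..b} (\<lambda>t. poly W t * (D t)\<^sup>2) \<le> e * M" if e: "0 < e" for e
  proof -
    obtain p where p: "\<And>t. t \<in> {a..b} \<Longrightarrow> \<bar>D t - poly p t\<bar> < e"
      using Weierstrass_poly[OF contD e] by blast
    have "integral {a..b} (\<lambda>t. poly W t * (D t)\<^sup>2)
        = integral {a..b} (\<lambda>t. poly W t * D t * (D t - poly p t) + poly W t * D t * poly p t)"
      by (simp add: algebra_simps power2_eq_square)
    also have "\<dots> = integral {a..b} (\<lambda>t. poly W t * D t * (D t - poly p t))"
      using orth by (subst integral_add) (auto intro!: int continuous_intros contD)
    also have "\<dots> \<le> integral {a..b} (\<lambda>t. e * (poly W t * \<bar>D t\<bar>))"
    proof (rule integral_le)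
      fix t assume t: "t \<in> {a..b}"
      have "poly W t * D t * (D t - poly p t) \<le> \<bar>poly W t * D t * (D t - poly p t)\<bar>"
        by (rule abs_ge_self)
      also have "\<dots> = poly W t * \<bar>D t\<bar> * \<bar>D t - poly p t\<bar>"
        using W0[of t] by (simp only: abs_mult abs_of_nonneg)
      also have "\<dots> \<le> poly W t * \<bar>D t\<bar> * e"
        using p[OF t] W0[of t] by (intro mult_left_mono) auto
      finally show "poly W t * D t * (D t - poly p t) \<le> e * (poly W t * \<bar>D t\<bar>)"
        by (simp add: mult_ac)
    qed (auto intro!: int continuous_intros contD)
    finally show ?thesis by (simp add: M_def)
  qed
  have "integral {a..b} (\<lambda>t. poly W t * (D t)\<^sup>2) \<le> 0"
  proof (rule field_le_epsilon)
    fix e :: real assume "0 < e"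
    have "integral {a..b} (\<lambda>t. poly W t * (D t)\<^sup>2) \<le> e / (\<bar>M\<bar> + 1) * M"
      using \<open>0 < e\<close> by (intro small) simp
    also have "\<dots> \<le> e / (\<bar>M\<bar> + 1) * (\<bar>M\<bar> + 1)"
      using \<open>0 < e\<close> by (intro mult_left_mono) auto
    also have "\<dots> = e" by simp
    finally show "integral {a..b} (\<lambda>t. poly W t * (D t)\<^sup>2) \<le> 0 + e" by simp
  qed
  moreover have "0 \<le> integral {a..b} (\<lambda>t. poly W t * (D t)\<^sup>2)"
    using W0 by (intro integral_nonneg int continuous_intros contD) simp
  ultimately have "\<forall>t\<in>{a..b}. poly W t * (D t)\<^sup>2 = 0"
    using W0 by (subst integral_eq_0_iff[symmetric]) (auto intro!: continuous_intros contD ab)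
  \<comment> \<open>\<open>W\<close> is positive in the open interval but may vanish at the
    endpoints; these are reached by continuity.\<close>
  then have "D t = 0" if "t \<in> {a<..<b}" for t
    using that by (force simp: W)
  then have "D t = 0" if "t \<in> {a..b}" for t
    using continuous_constant_on_closure[of "{a<..<b}" D 0 t] contD ab that by simp
  then show thesis using that[of c] by (simp add: D_def)
qed

section \<open>Integration by parts in all orders at once\<close>

context
  fixes n :: nat and a b :: real and F :: "nat \<Rightarrow> real \<Rightarrow> real"
  assumes n: "1 \<le> n" and ab: "a < b"
    and td: "\<And>j. j \<le> n \<Longrightarrow> times_differentiable_on n (F j) {a..b}"
begin

text \<open>Collects the boundary terms by the order \<open>k\<close> of the derivative falling on
  \<eta>. The coefficient \<open>N k\<close> that emerges is the left-hand side of the natural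
  boundary condition of order \<open>k\<close>.\<close>

lemma integration_by_parts_sum:
  defines "N \<equiv> \<lambda>k t. \<Sum>j=1..n-k. (-1) ^ (j - 1) * nderiv_on {a..b} (j - 1) (F (k + j)) t"
  shows "((\<lambda>t. (\<Sum>j\<le>n. F j t * poly ((pderiv ^^ j) \<eta>) t)
      - (\<Sum>j=0..n. (-1) ^ j * nderiv_on {a..b} j (F j) t) * poly \<eta> t) has_integral
    (\<Sum>k<n. N k b * poly ((pderiv ^^ k) \<eta>) b) - (\<Sum>k<n. N k a * poly ((pderiv ^^ k) \<eta>) a)) {a..b}"
proof -
  let ?B = "\<lambda>j t. \<Sum>i<j. (-1) ^ i * nderiv_on {a..b} i (F j) t * poly ((pderiv ^^ (j - 1 - i)) \<eta>) t"
  have eq: "(\<Sum>j\<le>n. ?B j t) = (\<Sum>k<n. N k t * poly ((pderiv ^^ k) \<eta>) t)" for t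
  proof -
    have "(\<Sum>j\<le>n. ?B j t) = (\<Sum>(j, i)\<in>(SIGMA j:{..n}. {..<j}).
        (-1) ^ i * nderiv_on {a..b} i (F j) t * poly ((pderiv ^^ (j - 1 - i)) \<eta>) t)"
      by (rule sum.Sigma) auto
    also have "\<dots> = (\<Sum>(k, l)\<in>(SIGMA k:{..<n}. {1..n-k}).
        (-1) ^ (l - 1) * nderiv_on {a..b} (l - 1) (F (k + l)) t * poly ((pderiv ^^ k) \<eta>) t)"
      by (rule sum.reindex_bij_witness[of _ "\<lambda>(k, l). (k + l, l - 1)" "\<lambda>(j, i). (j - 1 - i, i + 1)"]) auto
    also have "\<dots> = (\<Sum>k<n. N k t * poly ((pderiv ^^ k) \<eta>) t)"
      unfolding N_def sum_distrib_right by (rule sum.Sigma[symmetric]) auto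
    finally show ?thesis .
  qed
  have "((\<lambda>t. \<Sum>j\<le>n. F j t * poly ((pderiv ^^ j) \<eta>) t - (-1) ^ j * nderiv_on {a..b} j (F j) t * poly \<eta> t)
      has_integral (\<Sum>j\<le>n. ?B j b - ?B j a)) {a..b}"
    by (intro has_integral_sum integration_by_parts_higher[OF ab td]) auto
  then show ?thesis
    by (simp only: sum_subtractf eq sum_distrib_right[symmetric] atLeast0AtMost)
qed

text \<open>The \<open>n\<close>-th derivatives of the \<open>F j\<close> need not be continuous, nor even Lebesgue integrable. The sum
  is nevertheless a derivative, hence Henstock-Kurzweil integrable, and the du Bois-Reymond lemma
  is applied to its primitive \<open>G\<close>.\<close>

lemma weak_Euler_Lagrange:
  assumes test: "\<And>\<eta>. (\<And>k. k < n \<Longrightarrow> poly ((pderiv ^^ k) \<eta>) a = 0) \<Longrightarrow>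
        (\<And>k. k < n \<Longrightarrow> poly ((pderiv ^^ k) \<eta>) b = 0) \<Longrightarrow>
        ((\<lambda>t. \<Sum>j\<le>n. F j t * poly ((pderiv ^^ j) \<eta>) t) has_integral 0) {a..b}"
    and t: "t \<in> {a..b}"
  shows "(\<Sum>j=0..n. (-1) ^ j * nderiv_on {a..b} j (F j) t) = 0"
proof -
  define E where "E t = (\<Sum>j=0..n. (-1) ^ j * nderiv_on {a..b} j (F j) t)" for t
  \<comment> \<open>Only \<open>F 0\<close> has to be integrated; each term with
    \<open>j \<ge> 1\<close> has its primitive one order lower.\<close>
  define G where "G t = integral {a..t} (F 0) + (\<Sum>j=1..n. (-1) ^ j * nderiv_on {a..b} (j - 1) (F j) t)" for t
  have cont0: "continuous_on {a..b} (F 0)"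
    using continuous_on_nderiv_on[OF td[of 0], of 0] n by simp
  have derG: "(G has_real_derivative E t) (at t within {a..b})" if t: "t \<in> {a..b}" for t
  proof -
    have "((\<lambda>t. (-1) ^ j * nderiv_on {a..b} (j - 1) (F j) t) has_real_derivative
        (-1) ^ j * nderiv_on {a..b} j (F j) t) (at t within {a..b})" if "j \<in> {1..n}" for j
      using has_derivative_nderiv_on[OF td[of j] _ t, of "j - 1"] that by (intro DERIV_cmult) auto
    then have "(G has_real_derivative F 0 t + (\<Sum>j=1..n. (-1) ^ j * nderiv_on {a..b} j (F j) t)) (at t within {a..b})"
      unfolding G_def
      by (intro DERIV_add DERIV_sum integral_has_real_derivative[OF cont0 t])
    also have "F 0 t + (\<Sum>j=1..n. (-1) ^ j * nderiv_on {a..b} j (F j) t) = E t"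
      unfolding E_def by (subst (2) sum.atLeast_Suc_atMost) auto
    finally show ?thesis .
  qed
  have contG: "continuous_on {a..b} G"
    using derG by (rule DERIV_continuous_on)
  have "integral {a..b} (\<lambda>t. G t * poly (pderiv \<eta>) t) = 0"
    if \<eta>a: "\<And>k. k < n \<Longrightarrow> poly ((pderiv ^^ k) \<eta>) a = 0"
      and \<eta>b: "\<And>k. k < n \<Longrightarrow> poly ((pderiv ^^ k) \<eta>) b = 0" for \<eta>
  proof -
    have "((\<lambda>t. (\<Sum>j\<le>n. F j t * poly ((pderiv ^^ j) \<eta>) t) - E t * poly \<eta> t) has_integral 0) {a..b}"
      using integration_by_parts_sum[of \<eta>] by (simp add: \<eta>a \<eta>b E_def)
    from has_integral_diff[OF test[OF \<eta>a \<eta>b] this]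
    have 1: "((\<lambda>t. E t * poly \<eta> t) has_integral 0) {a..b}" by simp
    \<comment> \<open>The product \<open>G \<eta>\<close> vanishes at both endpoints and
      \<open>E \<eta>\<close> already integrates to 0, so the product rule leaves the integral of
      \<open>G \<eta>'\<close>, as du Bois-Reymond requires.\<close>
    have "((\<lambda>t. E t * poly \<eta> t + G t * poly (pderiv \<eta>) t) has_integral G b * poly \<eta> b - G a * poly \<eta> a) {a..b}"
    proof (rule fundamental_theorem_of_calculus)
      fix t assume t: "t \<in> {a..b}"
      show "((\<lambda>t. G t * poly \<eta> t) has_vector_derivative E t * poly \<eta> t + G t * poly (pderiv \<eta>) t) (at t within {a..b})"
        unfolding has_real_derivative_iff_has_vector_derivative[symmetric]
        by (rule derivative_eq_intros derG[OF t] DERIV_subset[OF poly_DERIV] refl subset_UNIV)+ simp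
    qed (use ab in simp)
    moreover have "poly \<eta> a = 0" "poly \<eta> b = 0" using \<eta>a[of 0] \<eta>b[of 0] n by auto
    ultimately have "((\<lambda>t. E t * poly \<eta> t + G t * poly (pderiv \<eta>) t) has_integral 0) {a..b}" by simp
    from has_integral_diff[OF this 1] show ?thesis by (simp add: integral_unique)
  qed
  then obtain c where c: "\<And>t. t \<in> {a..b} \<Longrightarrow> G t = c"
    using du_bois_reymond[OF ab contG, of n] by metis
  have "((\<lambda>_. c) has_vector_derivative E t) (at t within {a..b})"
    by (rule has_vector_derivative_transform[where f = G, OF t])
       (use c derG[OF t] in \<open>simp_all add: has_real_derivative_iff_has_vector_derivative\<close>)
  from vector_derivative_within_closed_interval[OF ab t this]
  have "E t = 0"
    using vector_derivative_within_closed_interval[OF ab t has_vector_derivative_const[of c]] by simp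
  then show ?thesis by (simp add: E_def)
qed

end

section \<open>First variation\<close>

context
  fixes n :: nat and a b \<gamma> :: real and idx :: "'m::finite \<Rightarrow> nat"
    and L :: "real \<times> (real ^ 'm) \<times> real \<Rightarrow> real"
    and L' :: "real \<times> (real ^ 'm) \<times> real \<Rightarrow> (real \<times> (real ^ 'm) \<times> real) \<Rightarrow>\<^sub>L real"
    and bca bcb :: "nat \<Rightarrow> real option" and x :: "real \<Rightarrow> real"
  assumes ab: "a < b" and idx: "bij_betw idx UNIV {..n}"
    and der: "\<And>p. (L has_derivative blinfun_apply (L' p)) (at p)"
    and cont': "continuous_on UNIV L'"
    and adm: "admissible n idx L a b \<gamma> bca bcb x"
begin

lemma idx_le: "idx i \<le> n"
  using idx bij_betwE by fastforce

lemma continuous_on_jet: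
  assumes "Ck_on (2 * n) y {a..b}"
  shows "continuous_on {a..b} (\<lambda>t. \<chi> i. nderiv_on {a..b} (idx i) y t)"
proof (intro continuous_on_vec_lambda)
  fix i
  have "idx i \<le> 2 * n" using idx_le[of i] by simp
  then show "continuous_on {a..b} (nderiv_on {a..b} (idx i) y)"
    by (rule Ck_on_imp_continuous_on_nderiv[OF assms])
qed

text \<open>\<open>z_of\<close> is a pointwise description; its continuity is inherited from an
  actual solution with which it agrees on the interval.\<close>

lemma continuous_on_bracket_z_of: "continuous_on {a..b} (bracket idx a b x (z_of idx L a b \<gamma> x))"
proof -
  obtain z where z: "solves_ivp idx L a b \<gamma> x z" and x: "Ck_on (2 * n) x {a..b}"
    using adm by (auto simp: admissible_def)
  have "continuous_on {a..b} z"
    using z unfolding solves_ivp_def by (intro DERIV_continuous_on) blast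
  then have "continuous_on {a..b} (z_of idx L a b \<gamma> x)"
    by (rule continuous_on_eq) (simp add: z_of_eq[OF der cont' continuous_on_jet[OF x] z])
  then show ?thesis
    unfolding bracket_def by (intro continuous_intros continuous_on_jet[OF x])
qed

lemma continuous_on_Lz_along: "continuous_on {a..b} (Lz_along idx L a b \<gamma> x)"
proof -
  have "Lz_along idx L a b \<gamma> x =
      (\<lambda>t. L' (bracket idx a b x (z_of idx L a b \<gamma> x) t) (0, 0, 1))"
    by (rule ext) (simp only: Lz_along_def partial_z_eq[OF der])
  then show ?thesis
    by (simp only:) (rule blinfun.continuous_on[OF
        continuous_on_L'[OF der cont' continuous_on_bracket_z_of] continuous_on_const])
qed

lemma continuous_on_Lx_along:
  assumes "j \<le> n"
  shows "continuous_on {a..b} (Lx_along idx L a b \<gamma> x j)"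
proof -
  have inj: "inj idx" using idx by (rule bij_betw_imp_inj_on)
  obtain i where "j = idx i" using assms idx by (metis atMost_iff bij_betw_iff_bijections)
  then have "Lx_along idx L a b \<gamma> x j =
      (\<lambda>t. L' (bracket idx a b x (z_of idx L a b \<gamma> x) t) (0, axis i 1, 0))"
    by (intro ext) (simp only: Lx_along_def partial_x_eq[OF der inj])
  then show ?thesis
    by (simp only:) (rule blinfun.continuous_on[OF
        continuous_on_L'[OF der cont' continuous_on_bracket_z_of] continuous_on_const])
qed

text \<open>This linear equation serves twice: for the higher differentiability of the weight and
  for its role as integrating factor.\<close>

lemma weight_has_real_derivative:
  assumes "t \<in> {a..b}"
  shows "(weight idx L a b \<gamma> x has_real_derivative
    - Lz_along idx L a b \<gamma> x t * weight idx L a b \<gamma> x t) (at t within {a..b})"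
  unfolding weight_def
  by (rule derivative_eq_intros integral_has_real_derivative[OF continuous_on_Lz_along assms] refl)+ simp

lemma first_variation:
  fixes \<eta> :: "real poly"
  assumes ext: "extremizer n idx L a b \<gamma> bca bcb x"
    and \<eta>a: "\<And>k. k < n \<Longrightarrow> bca k \<noteq> None \<Longrightarrow> poly ((pderiv ^^ k) \<eta>) a = 0"
    and \<eta>b: "\<And>k. k < n \<Longrightarrow> bcb k \<noteq> None \<Longrightarrow> poly ((pderiv ^^ k) \<eta>) b = 0"
  shows "((\<lambda>t. weight idx L a b \<gamma> x t * (\<Sum>j\<le>n. Lx_along idx L a b \<gamma> x j t * poly ((pderiv ^^ j) \<eta>) t))
    has_integral 0) {a..b}"
proof -
  define w where "w = weight idx L a b \<gamma> x"
  define c where "c = Lz_along idx L a b \<gamma> x"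
  define g where "g t = (\<Sum>j\<le>n. Lx_along idx L a b \<gamma> x j t * poly ((pderiv ^^ j) \<eta>) t)" for t
  define Y :: "real \<Rightarrow> real ^ 'm" where "Y t = (\<chi> i. nderiv_on {a..b} (idx i) x t)" for t
  define H :: "real \<Rightarrow> real ^ 'm" where "H t = (\<chi> i. poly ((pderiv ^^ idx i) \<eta>) t)" for t
  obtain z where z: "solves_ivp idx L a b \<gamma> x z" and x: "Ck_on (2 * n) x {a..b}"
    and bc: "boundary_ok n a b bca bcb x"
    using adm by (auto simp: admissible_def)
  have z_of: "z_of idx L a b \<gamma> x t = z t" if "t \<in> {a..b}" for t
    using z_of_eq[OF der cont' continuous_on_jet[OF x] z that] .
  have contY: "continuous_on {a..b} Y"
    unfolding Y_def by (rule continuous_on_jet[OF x])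
  have contH: "continuous_on {a..b} H"
    unfolding H_def by (intro continuous_on_vec_lambda continuous_intros)
  have z': "(z has_real_derivative L (t, Y t, z t)) (at t within {a..b})" if "t \<in> {a..b}" for t
    using z that by (auto simp: solves_ivp_def bracket_def Y_def)
  have c: "c t = L' (t, Y t, z t) (0, 0, 1)" if "t \<in> {a..b}" for t
    by (simp add: c_def Lz_along_def partial_z_eq[OF der] bracket_def z_of[OF that] Y_def)
  have g: "g t = L' (t, Y t, z t) (0, H t, 0)" if "t \<in> {a..b}" for t
    unfolding g_def Lx_along_def
    by (subst sum_partial_x[OF der idx]) (simp add: bracket_def z_of[OF that] Y_def H_def)
  have w': "(w has_real_derivative - c t * w t) (at t within {a..b})" if "t \<in> {a..b}" for t
    unfolding w_def c_def by (rule weight_has_real_derivative[OF that])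
  have w0: "w t \<noteq> 0" for t by (simp add: w_def weight_def)
  have contw: "continuous_on {a..b} w" using w' by (rule DERIV_continuous_on)
  have contwg: "continuous_on {a..b} (\<lambda>t. w t * g t)"
    unfolding g_def by (intro continuous_intros contw continuous_on_Lx_along) auto
  define u where "u t = integral {a..t} (\<lambda>t. w t * g t)" for t
  \<comment> \<open>Variation of constants: \<open>w \<zeta>\<close> has derivative
    \<open>w g\<close>, so \<open>\<zeta> b = 0\<close> says exactly that the weighted integral
    vanishes.\<close>
  define \<zeta> where "\<zeta> t = u t / w t" for t
  have u': "(u has_real_derivative w t * g t) (at t within {a..b})" if "t \<in> {a..b}" for t
    unfolding u_def by (rule integral_has_real_derivative[OF contwg that])
  have \<zeta>': "(\<zeta> has_real_derivative L' (t, Y t, z t) (0, H t, \<zeta> t)) (at t within {a..b})"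
    if t: "t \<in> {a..b}" for t
  proof -
    have "(\<zeta> has_real_derivative (w t * g t * w t - u t * (- c t * w t)) / (w t * w t)) (at t within {a..b})"
      unfolding \<zeta>_def by (rule DERIV_divide[OF u'[OF t] w'[OF t] w0])
    also have "(w t * g t * w t - u t * (- c t * w t)) / (w t * w t) = g t + \<zeta> t * c t"
      using w0[of t] by (simp add: \<zeta>_def field_simps)
    also have "\<dots> = L' (t, Y t, z t) ((0, H t, 0) + \<zeta> t *\<^sub>R (0, 0, 1))"
      unfolding blinfun.add_right blinfun.scaleR_right g[OF t] c[OF t] by simp
    also have "(0 :: real, H t, 0 :: real) + \<zeta> t *\<^sub>R (0, 0, 1) = (0, H t, \<zeta> t)" by simp
    finally show ?thesis .
  qed
  have "\<zeta> b = 0"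
  proof (rule ccontr)
    assume \<zeta>b: "\<zeta> b \<noteq> 0"
    have \<zeta>a: "\<zeta> a = 0" by (simp add: \<zeta>_def u_def)
    \<comment> \<open>With tolerance \<open>\<bar>\<zeta> b\<bar> / 2\<close> the error is at most
      half of the first-order change, so the sign of \<open>\<epsilon> * \<zeta> b\<close> decides
      the comparison.\<close>
    obtain d where d: "0 < d" "\<And>\<epsilon>. \<bar>\<epsilon>\<bar> < d \<Longrightarrow> \<exists>v. v a = z a \<and>
      (\<forall>t\<in>{a..b}. (v has_real_derivative L (t, Y t + \<epsilon> *\<^sub>R H t, v t)) (at t within {a..b})) \<and>
      \<bar>v b - (z b + \<epsilon> * \<zeta> b)\<bar> \<le> \<bar>\<epsilon>\<bar> * (\<bar>\<zeta> b\<bar> / 2)"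
      using ivp_perturbation[OF der cont' ab contY contH z' \<zeta>' \<zeta>a, of "\<bar>\<zeta> b\<bar> / 2"] \<zeta>b by auto
    have near: "\<exists>y. admissible n idx L a b \<gamma> bca bcb y \<and>
      \<bar>z_of idx L a b \<gamma> y b - (z_of idx L a b \<gamma> x b + \<epsilon> * \<zeta> b)\<bar> \<le> \<bar>\<epsilon> * \<zeta> b\<bar> / 2"
      if \<epsilon>: "\<bar>\<epsilon>\<bar> < d" for \<epsilon>
    proof -
      define y where "y t = x t + \<epsilon> * poly \<eta> t" for t
      obtain v where v: "v a = z a"
        "\<And>t. t \<in> {a..b} \<Longrightarrow> (v has_real_derivative L (t, Y t + \<epsilon> *\<^sub>R H t, v t)) (at t within {a..b})"
        "\<bar>v b - (z b + \<epsilon> * \<zeta> b)\<bar> \<le> \<bar>\<epsilon>\<bar> * (\<bar>\<zeta> b\<bar> / 2)"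
        using d(2)[OF \<epsilon>] by blast
      have Ck: "Ck_on (2 * n) y {a..b}"
        unfolding y_def by (rule Ck_on_add_poly[OF ab x])
      have jet: "nderiv_on {a..b} k y t = nderiv_on {a..b} k x t + \<epsilon> * poly ((pderiv ^^ k) \<eta>) t"
        if "k \<le> n" "t \<in> {a..b}" for k t
        unfolding y_def using x that
        by (intro nderiv_on_add_poly(1)[OF ab, where m = "2 * n"]) (auto simp: Ck_on_def)
      have "boundary_ok n a b bca bcb y"
        using bc ab by (auto simp: boundary_ok_def jet \<eta>a \<eta>b)
      moreover have br: "bracket idx a b y v t = (t, Y t + \<epsilon> *\<^sub>R H t, v t)" if "t \<in> {a..b}" for t
        using jet[OF idx_le that] by (simp add: bracket_def Y_def H_def vec_eq_iff)
      then have v_solves: "solves_ivp idx L a b \<gamma> y v"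
        using v(1,2) z by (simp add: solves_ivp_def)
      ultimately have "admissible n idx L a b \<gamma> bca bcb y"
        using Ck by (auto simp: admissible_def)
      moreover have "z_of idx L a b \<gamma> y b = v b"
        using z_of_eq[OF der cont' continuous_on_jet[OF Ck] v_solves] ab by simp
      ultimately show ?thesis
        using v(3) z_of[of b] ab by (intro exI[of _ y]) (simp add: abs_mult)
    qed
    \<comment> \<open>Opposite values of \<epsilon> give competitors strictly on both sides of
      \<open>x\<close>, which excludes a minimum and a maximum alike.\<close>
    obtain y1 y2 where "admissible n idx L a b \<gamma> bca bcb y1" "admissible n idx L a b \<gamma> bca bcb y2"
      and y: "\<bar>z_of idx L a b \<gamma> y1 b - (z_of idx L a b \<gamma> x b + d / 2 * \<zeta> b)\<bar> \<le> \<bar>d / 2 * \<zeta> b\<bar> / 2"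
        "\<bar>z_of idx L a b \<gamma> y2 b - (z_of idx L a b \<gamma> x b + - (d / 2) * \<zeta> b)\<bar> \<le> \<bar>- (d / 2) * \<zeta> b\<bar> / 2"
      using near[of "d / 2"] near[of "- (d / 2)"] d(1) by auto
    then have "z_of idx L a b \<gamma> x b \<le> z_of idx L a b \<gamma> y1 b \<and> z_of idx L a b \<gamma> x b \<le> z_of idx L a b \<gamma> y2 b \<or>
        z_of idx L a b \<gamma> y1 b \<le> z_of idx L a b \<gamma> x b \<and> z_of idx L a b \<gamma> y2 b \<le> z_of idx L a b \<gamma> x b"
      using ext by (auto simp: extremizer_def)
    moreover define m where "m = d / 2 * \<zeta> b"
    have "m \<noteq> 0" using d(1) \<zeta>b by (simp add: m_def)
    moreover have "- (d / 2) * \<zeta> b = - m" by (simp add: m_def)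
    ultimately show False
      using y unfolding m_def[symmetric] by linarith
  qed
  then have "u b = 0" using w0[of b] by (simp add: \<zeta>_def)
  then have "((\<lambda>t. w t * g t) has_integral 0) {a..b}"
    using integrable_integral[OF integrable_continuous_real[OF contwg]] by (simp add: u_def)
  then show ?thesis by (simp add: w_def g_def)
qed

end

section \<open>The Euler-Lagrange equation and the natural boundary conditions\<close>

theorem theorem7:
  fixes n :: nat and a b \<gamma> :: real
    and idx :: "'m::finite \<Rightarrow> nat"
    and L :: "real \<times> (real ^ 'm) \<times> real \<Rightarrow> real"
    and bca bcb :: "nat \<Rightarrow> real option"
    and x :: "real \<Rightarrow> real"
  assumes "n \<ge> 1" and "a < b"
    and "bij_betw idx UNIV {..n}"
    and "C1_UNIV L"
    and "hypothesis_H2 n idx L a b \<gamma> bca bcb"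
    and "extremizer n idx L a b \<gamma> bca bcb x"
  shows "(\<forall>t\<in>{a..b}.
            (\<Sum>j=0..n. (-1) ^ j * nderiv_on {a..b} j
               (\<lambda>s. weight idx L a b \<gamma> x s * Lx_along idx L a b \<gamma> x j s) t) = 0) \<and>
         (\<forall>k<n. bcb k = None \<longrightarrow>
            (\<Sum>j=1..n-k. (-1) ^ (j - 1) * nderiv_on {a..b} (j - 1)
               (\<lambda>s. weight idx L a b \<gamma> x s * Lx_along idx L a b \<gamma> x (k + j) s) b) = 0) \<and>
         (\<forall>k<n. bca k = None \<longrightarrow>
            (\<Sum>j=1..n-k. (-1) ^ (j - 1) * nderiv_on {a..b} (j - 1)
               (\<lambda>s. weight idx L a b \<gamma> x s * Lx_along idx L a b \<gamma> x (k + j) s) a) = 0)"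
proof -
  note ab = \<open>a < b\<close>
  obtain L' where der: "\<And>p. (L has_derivative blinfun_apply (L' p)) (at p)"
    and cont': "continuous_on UNIV L'"
    using \<open>C1_UNIV L\<close> by (auto simp: C1_UNIV_def)
  have adm: "admissible n idx L a b \<gamma> bca bcb x"
    using assms(6) by (simp add: extremizer_def)
  define F where "F = (\<lambda>j s. weight idx L a b \<gamma> x s * Lx_along idx L a b \<gamma> x j s)"
  define N where "N k t = (\<Sum>j=1..n-k. (-1) ^ (j - 1) * nderiv_on {a..b} (j - 1) (F (k + j)) t)" for k t
  have td: "times_differentiable_on n (F j) {a..b}" if "j \<le> n" for j
  proof -
    have H2: "times_differentiable_on n (Lx_along idx L a b \<gamma> x j) {a..b}"
      "times_differentiable_on n (Lz_along idx L a b \<gamma> x) {a..b}"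
      using assms(5) adm that by (auto simp: hypothesis_H2_def)
    have "times_differentiable_on n (weight idx L a b \<gamma> x) {a..b}"
      by (rule times_differentiable_on_linear_ode[OF ab])
         (rule weight_has_real_derivative[OF ab assms(3) der cont' adm],
          assumption, rule times_differentiable_on_minus[OF ab H2(2)])
    then show ?thesis
      unfolding F_def by (intro times_differentiable_on_mult[OF ab] H2(1))
  qed
  have var: "((\<lambda>t. \<Sum>j\<le>n. F j t * poly ((pderiv ^^ j) \<eta>) t) has_integral 0) {a..b}"
    if "\<And>k. k < n \<Longrightarrow> bca k \<noteq> None \<Longrightarrow> poly ((pderiv ^^ k) \<eta>) a = 0"
      and "\<And>k. k < n \<Longrightarrow> bcb k \<noteq> None \<Longrightarrow> poly ((pderiv ^^ k) \<eta>) b = 0" for \<eta>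
    using first_variation[OF ab assms(3) der cont' adm assms(6) that]
    by (simp add: F_def sum_distrib_left mult.assoc)
  \<comment> \<open>Test polynomials whose derivatives below order \<open>n\<close> vanish at both
    ends are compatible with any boundary data.\<close>
  have EL: "(\<Sum>j=0..n. (-1) ^ j * nderiv_on {a..b} j (F j) t) = 0" if "t \<in> {a..b}" for t
    by (rule weak_Euler_Lagrange[OF assms(1) ab td _ that]) (auto intro: var)
  \<comment> \<open>Once the Euler-Lagrange expression is 0 pointwise, integration by parts equates
    the first variation with the boundary terms alone.\<close>
  have boundary: "(\<Sum>k<n. N k b * poly ((pderiv ^^ k) \<eta>) b) = (\<Sum>k<n. N k a * poly ((pderiv ^^ k) \<eta>) a)"
    if "\<And>k. k < n \<Longrightarrow> bca k \<noteq> None \<Longrightarrow> poly ((pderiv ^^ k) \<eta>) a = 0"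
      and "\<And>k. k < n \<Longrightarrow> bcb k \<noteq> None \<Longrightarrow> poly ((pderiv ^^ k) \<eta>) b = 0" for \<eta>
  proof -
    let ?S = "\<lambda>t. \<Sum>j\<le>n. F j t * poly ((pderiv ^^ j) \<eta>) t"
    have "((\<lambda>t. ?S t - (\<Sum>j=0..n. (-1) ^ j * nderiv_on {a..b} j (F j) t) * poly \<eta> t) has_integral
        (\<Sum>k<n. N k b * poly ((pderiv ^^ k) \<eta>) b) - (\<Sum>k<n. N k a * poly ((pderiv ^^ k) \<eta>) a)) {a..b}"
      unfolding N_def by (rule integration_by_parts_sum[OF assms(1) ab td])
    then have "(?S has_integral (\<Sum>k<n. N k b * poly ((pderiv ^^ k) \<eta>) b)
        - (\<Sum>k<n. N k a * poly ((pderiv ^^ k) \<eta>) a)) {a..b}"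
      by (rule has_integral_eq[rotated]) (simp only: EL mult_zero_left diff_zero)
    from has_integral_unique[OF this var[OF that]] show ?thesis by simp
  qed
  have "N k b = 0" if k: "k < n" "bcb k = None" for k
  proof -
    \<comment> \<open>This variation changes only the free derivative of order \<open>k\<close> at
      \<open>b\<close>, so it respects all prescribed data and isolates
      \<open>N k b\<close>.\<close>
    obtain h where h: "[:- a, 1:] ^ n dvd h"
      "\<And>i. i < n \<Longrightarrow> poly ((pderiv ^^ i) h) b = (if i = k then 1 else 0)"
      using hermite_delta[OF less_imp_neq[OF ab] k(1)] by metis
    have h0: "poly ((pderiv ^^ i) h) a = 0" if "i < n" for i
      by (rule higher_pderiv_root[OF h(1) that])
    have "(\<Sum>i<n. N i b * poly ((pderiv ^^ i) h) b) = (\<Sum>i<n. N i a * poly ((pderiv ^^ i) h) a)"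
      by (rule boundary) (use h(2) h0 that in \<open>auto split: if_splits\<close>)
    then show ?thesis
      using that(1) by (simp add: h(2) h0 if_distrib cong: if_cong)
  qed
  moreover have "N k a = 0" if k: "k < n" "bca k = None" for k
  proof -
    obtain h where h: "[:- b, 1:] ^ n dvd h"
      "\<And>i. i < n \<Longrightarrow> poly ((pderiv ^^ i) h) a = (if i = k then 1 else 0)"
      using hermite_delta[OF less_imp_neq[OF ab, symmetric] k(1)] by metis
    have h0: "poly ((pderiv ^^ i) h) b = 0" if "i < n" for i
      by (rule higher_pderiv_root[OF h(1) that])
    have "(\<Sum>i<n. N i b * poly ((pderiv ^^ i) h) b) = (\<Sum>i<n. N i a * poly ((pderiv ^^ i) h) a)"
      by (rule boundary) (use h(2) h0 that in \<open>auto split: if_splits\<close>)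
    then show ?thesis
      using that(1) by (simp add: h(2) h0 if_distrib cong: if_cong)
  qed
  ultimately show ?thesis
    using EL unfolding N_def F_def by blast
qed

end
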